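(* There is a constant $C$ such that for all sufficiently large $n$ and every positive integer $b$ with $b \le \frac{n}{\ln n}-\frac{Cn}{(\ln n)^{3/2}}$, Maker can win the biased Hamilton cycle game with bias $b$ on the complete graph $K_n$ within $n+\frac{Cn}{(\ln n)^{1/2}}$ steps (that is, Maker has a strategy which guarantees, whatever Breaker does, that she has chosen all edges of a Hamilton cycle of $K_n$ after at most this many of her own moves).
   Context: The biased (Maker-Breaker) Hamilton cycle game with bias $b$ on $K_n$ is played by two players, Maker and Breaker, who alternately select previously unselected edges of $K_n$, with Breaker moving first. In each of his turns Breaker selects $b$ edges; in each of her turns Maker selects one edge. Maker wins when she has chosen all the edges of a Hamilton cycle of $K_n$; if she never does so, Breaker wins. *)

theory Defs
  imports Complex_Main
begin

definition complete_edges :: "nat \<Rightarrow> nat set set" where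
  "complete_edges n = {e. e \<subseteq> {..<n} \<and> card e = 2}"

definition is_hamilton_cycle :: "nat \<Rightarrow> nat set set \<Rightarrow> bool" where
  "is_hamilton_cycle n H \<longleftrightarrow> n \<ge> 3 \<and>
     (\<exists>vs. distinct vs \<and> set vs = {..<n} \<and>
        H = (\<lambda>i. {vs ! i, vs ! (Suc i mod n)}) ` {..<n})"

(* A strategy for Maker chooses her next edge from the list of all moves Breaker has made so
   far; her own earlier moves are determined by the strategy and this list. *)
type_synonym maker_strategy = "nat set set list \<Rightarrow> nat set"

(* Breaker's moves are X 0, X 1, X 2, ...; Maker answers X i with maker_move \<sigma> X i. *)
definition maker_move :: "maker_strategy \<Rightarrow> (nat \<Rightarrow> nat set set) \<Rightarrow> nat \<Rightarrow> nat set" where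
  "maker_move \<sigma> X i = \<sigma> (map X [0..<Suc i])"

definition maker_edges :: "maker_strategy \<Rightarrow> (nat \<Rightarrow> nat set set) \<Rightarrow> nat \<Rightarrow> nat set set" where
  "maker_edges \<sigma> X k = maker_move \<sigma> X ` {..<k}"

definition breaker_edges :: "(nat \<Rightarrow> nat set set) \<Rightarrow> nat \<Rightarrow> nat set set" where
  "breaker_edges X k = (\<Union>i<k. X i)"

definition free_edges ::
  "nat \<Rightarrow> maker_strategy \<Rightarrow> (nat \<Rightarrow> nat set set) \<Rightarrow> nat \<Rightarrow> nat set set" where
  "free_edges n \<sigma> X k = complete_edges n - (maker_edges \<sigma> X k \<union> breaker_edges X k)"

(* If fewer than b edges are left, Breaker takes all of them. *)
definition legal_breaker_move ::
  "nat \<Rightarrow> nat \<Rightarrow> maker_strategy \<Rightarrow> (nat \<Rightarrow> nat set set) \<Rightarrow> nat \<Rightarrow> bool" where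
  "legal_breaker_move n b \<sigma> X k \<longleftrightarrow>
     X k \<subseteq> free_edges n \<sigma> X k \<and> card (X k) = min b (card (free_edges n \<sigma> X k))"

definition legal_maker_move ::
  "nat \<Rightarrow> maker_strategy \<Rightarrow> (nat \<Rightarrow> nat set set) \<Rightarrow> nat \<Rightarrow> bool" where
  "legal_maker_move n \<sigma> X k \<longleftrightarrow> maker_move \<sigma> X k \<in> free_edges n \<sigma> X k - X k"

(* Plays are indexed by infinite sequences of Breaker moves: once the board is full his only
   legal move is the empty set, and Maker has no legal move. Moves made after Maker has
   completed a Hamilton cycle are irrelevant. *)
definition maker_wins_within :: "nat \<Rightarrow> nat \<Rightarrow> real \<Rightarrow> bool" where
  "maker_wins_within n b t \<longleftrightarrow>
     (\<exists>\<sigma>. \<forall>X. (\<forall>k. legal_breaker_move n b \<sigma> X k) \<longrightarrow>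
        (\<exists>k. real k \<le> t \<and> (\<forall>i<k. legal_maker_move n \<sigma> X i) \<and>
             (\<exists>H. is_hamilton_cycle n H \<and> H \<subseteq> maker_edges \<sigma> X k)))"

end

theory Submission
  imports Defs
begin

text \<open>
  Maker keeps a list of all vertices and reads it as a cyclic order. A gap is a pair of cyclically
  consecutive vertices whose edge is not hers; without gaps the order is a Hamilton cycle of her
  graph. Her only way to change the order is a rotation: she opens it at a gap between the last
  vertex \<open>v\<close> and the first vertex \<open>u\<close>, joins \<open>v\<close> to some \<open>x\<close> in the list and reverses everything
  behind \<open>x\<close>. If \<open>y\<close> was the successor of \<open>x\<close>, the gap \<open>{v, u}\<close> disappears and the pair \<open>{y, u}\<close> may
  become a gap. So the number of gaps does not grow, and \<open>y\<close> is the only vertex that may be at more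
  gaps than before.

  Put \<open>L = ln n\<close> and \<open>w = n / sqrt L\<close>. In about \<open>n\<close> rounds Breaker takes at most \<open>2 * w\<^sup>2\<close> edges, so
  that only \<open>O(w)\<close> vertices ever reach Breaker-degree \<open>\<tau>\<close>, where \<open>\<tau>\<close> is about \<open>w\<close>. These vertices
  are called dangerous here, and \<open>O(w)\<close> extra moves can be spent on them. Four kinds of moves suffice.

  \<^item> If some dangerous vertex is at a gap, Maker rotates at the worst such vertex and makes a vertex
    \<open>y\<close> that is not dangerous the new end. A dangerous vertex therefore never gets a new gap and is treated at
    most twice. How far Breaker gets is a box game, analysed in \<open>box_inv_step\<close> and
    \<open>box_inv_degree\<close>: his degree at the vertex being treated stays below \<open>b * ln n + O(w)\<close>. This is less than
    \<open>n\<close> by a constant multiple of \<open>w\<close> because \<open>b * ln n \<le> n - C * w\<close>, so Maker has a choice of edges.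
  \<^item> Otherwise every vertex at a gap has Breaker-degree below \<open>\<tau>\<close>. While there are more
    than \<open>\<tau>\<close> gaps, one edge joins two of them (\<open>greedy_move\<close>). After at most \<open>n\<close> such moves
    \<open>O(w)\<close> gaps are left.
  \<^item> Then Maker fixes a set \<open>T\<close> of \<open>t = O(w)\<close> vertices, no two of them consecutive, and the set \<open>A\<close> of their
    neighbours in the cyclic order, and gives every vertex of \<open>A\<close> nine edges into \<open>T\<close>. A potential function selects
    these edges so that small subsets of \<open>A\<close> have many neighbours in \<open>T\<close> (\<open>trap_potential_extend\<close>,
    \<open>trap_potential_expansion\<close>). Breaker can make some vertices of \<open>A\<close> useless, but
    removing few vertices leaves an expanding core (\<open>expanding_core\<close>).
  \<^item> If the end \<open>v\<close> of the open order lies in the core, rotations along Maker's edges that break only pairs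
    at \<open>T\<close> replace \<open>v\<close> by more than \<open>\<tau>\<close> possible ends (\<open>posa_rotations\<close>). The other
    end \<open>u\<close> has Breaker-degree below \<open>\<tau>\<close>, so Maker can join \<open>u\<close> to one of them and the gap
    is closed (\<open>merge_move\<close>). From any other gap, one rotation at a suitable vertex of \<open>T\<close>
    brings the end into the core (\<open>jump_makes_rich\<close>). Each of the remaining gaps costs two moves.

  Altogether \<open>n + O(w)\<close> moves are made. The locale \<open>hamilton_strategy\<close> collects the
  inequalities between the parameters that these steps need, and \<open>maker_wins\<close> runs the
  strategy as one invariant with counters.
\<close>

section \<open>Strategies from invariants\<close>

text \<open>
  A strategy sees Breaker's moves only; Maker recomputes the whole position from them and chooses
  a reply that preserves the invariant. The invariant bounds the number of rounds, so it cannot be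
  preserved forever, and the only way it can fail is that a Hamilton cycle has appeared.
\<close>

lemma maker_wins_by_invariant:
  fixes Inv :: "nat \<Rightarrow> nat set set \<Rightarrow> nat set set \<Rightarrow> bool"
  assumes init: "Inv 0 {} {}"
    and bound: "\<And>k M B. Inv k M B \<Longrightarrow> real k \<le> t"
    and step: "\<And>k M B X. Inv k M B \<Longrightarrow> \<not> (\<exists>H. is_hamilton_cycle n H \<and> H \<subseteq> M) \<Longrightarrow>
      X \<subseteq> complete_edges n - (M \<union> B) \<Longrightarrow> card X \<le> b \<Longrightarrow>
      \<exists>e. e \<in> complete_edges n - (M \<union> B \<union> X) \<and> Inv (Suc k) (insert e M) (B \<union> X)"
  shows "maker_wins_within n b t"
proof -
  define good where "good k M B X e \<longleftrightarrow> e \<in> complete_edges n - (M \<union> B \<union> X) \<and>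
      Inv (Suc k) (insert e M) (B \<union> X)" for k M B X e
  define choice where "choice k M B X = (SOME e. good k M B X e)" for k M B X
  define play where "play = (\<lambda>(k, M, B) X. (Suc k, insert (choice k M B X) M, B \<union> X))"
  define state where "state xs = foldl play (0, {}, {}) xs" for xs
  define \<sigma> where "\<sigma> xs = (let (k, M, B) = state (butlast xs) in choice k M B (last xs))" for xs
  have "\<exists>k. real k \<le> t \<and> (\<forall>i<k. legal_maker_move n \<sigma> X i) \<and>
      (\<exists>H. is_hamilton_cycle n H \<and> H \<subseteq> maker_edges \<sigma> X k)"
    if X: "\<forall>k. legal_breaker_move n b \<sigma> X k" for X
  proof -
    define won where "won k \<longleftrightarrow> (\<exists>H. is_hamilton_cycle n H \<and> H \<subseteq> maker_edges \<sigma> X k)" for k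
    define st where "st k = state (map X [0..<k])" for k
    have st_Suc: "st (Suc k) = play (st k) (X k)" for k
      by (simp add: st_def state_def)
    have move: "maker_move \<sigma> X k = (let (i, M, B) = st k in choice i M B (X k))" for k
      by (simp add: maker_move_def \<sigma>_def st_def)
    have st: "st k = (k, maker_edges \<sigma> X k, breaker_edges X k)" for k
    proof (induction k)
      case 0
      show ?case by (simp add: st_def state_def maker_edges_def breaker_edges_def)
    next
      case (Suc k)
      then show ?case
        by (auto simp: st_Suc play_def maker_edges_def breaker_edges_def lessThan_Suc move)
    qed
    have inv: "Inv k (maker_edges \<sigma> X k) (breaker_edges X k) \<and> (\<forall>i<k. legal_maker_move n \<sigma> X i)"
      if "\<forall>i<k. \<not> won i" for k
      using that
    proof (induction k)
      case 0
      show ?case using init by (simp add: maker_edges_def breaker_edges_def)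
    next
      case (Suc k)
      let ?M = "maker_edges \<sigma> X k" and ?B = "breaker_edges X k"
      have IH: "Inv k ?M ?B" "\<forall>i<k. legal_maker_move n \<sigma> X i" using Suc by auto
      have "X k \<subseteq> complete_edges n - (?M \<union> ?B)" "card (X k) \<le> b"
        using X by (auto simp: legal_breaker_move_def free_edges_def)
      moreover have "\<not> (\<exists>H. is_hamilton_cycle n H \<and> H \<subseteq> ?M)"
        using Suc.prems by (auto simp: won_def)
      ultimately have "\<exists>e. good k ?M ?B (X k) e"
        unfolding good_def using step[OF IH(1)] by blast
      then have g: "good k ?M ?B (X k) (choice k ?M ?B (X k))"
        unfolding choice_def by (rule someI_ex)
      have mv: "maker_move \<sigma> X k = choice k ?M ?B (X k)" by (simp add: move st)
      have "maker_edges \<sigma> X (Suc k) = insert (choice k ?M ?B (X k)) ?M"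
        by (simp add: maker_edges_def lessThan_Suc mv)
      moreover have "breaker_edges X (Suc k) = ?B \<union> X k"
        by (auto simp: breaker_edges_def less_Suc_eq)
      moreover have "legal_maker_move n \<sigma> X k"
        using g by (auto simp: legal_maker_move_def free_edges_def mv good_def)
      ultimately show ?case
        using IH g by (auto simp: good_def less_Suc_eq)
    qed
    have "\<exists>k. won k \<and> real k \<le> t"
    proof (rule ccontr)
      assume *: "\<not> ?thesis"
      have nw: "\<not> won k" for k
      proof (induction k rule: less_induct)
        case (less k)
        then show ?case using inv[of k] bound * by blast
      qed
      define k where "k = nat \<lfloor>t\<rfloor> + 1"
      have "real k \<le> t" using inv[of k] bound nw by blast
      then show False unfolding k_def by linarith
    qed
    then obtain k0 where "won k0" "real k0 \<le> t" by blast
    define k where "k = (LEAST k. won k)"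
    have "won k" "\<forall>i<k. \<not> won i" "k \<le> k0"
      using \<open>won k0\<close> by (auto simp: k_def intro: LeastI Least_le dest: not_less_Least)
    then show ?thesis using inv[of k] \<open>real k0 \<le> t\<close> unfolding won_def
      by (intro exI[of _ k]) auto
  qed
  then show ?thesis unfolding maker_wins_within_def by blast
qed

section \<open>Cyclic orders, gaps and rotations\<close>

fun pairs :: "'a list \<Rightarrow> 'a set set" where
  "pairs (x # y # zs) = insert {x, y} (pairs (y # zs))"
| "pairs _ = {}"

definition cyc :: "'a list \<Rightarrow> 'a set set" where
  "cyc p = insert {last p, hd p} (pairs p)"

lemma pairs_append:
  "xs \<noteq> [] \<Longrightarrow> ys \<noteq> [] \<Longrightarrow> pairs (xs @ ys) = insert {last xs, hd ys} (pairs xs \<union> pairs ys)"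
proof (induction xs rule: pairs.induct)
  case ("2_2" v)
  then show ?case by (cases ys) auto
qed auto

lemma pairs_Cons: "ys \<noteq> [] \<Longrightarrow> pairs (x # ys) = insert {x, hd ys} (pairs ys)"
  by (cases ys) auto

lemma pairs_rev: "pairs (rev p) = pairs p"
proof (induction p)
  case (Cons x p)
  then show ?case
    by (cases "p = []") (auto simp: pairs_append pairs_Cons last_rev insert_commute)
qed simp

lemma pairs_subset: "e \<in> pairs p \<Longrightarrow> e \<subseteq> set p"
  by (induction p rule: pairs.induct) auto

lemma cyc_subset: "p \<noteq> [] \<Longrightarrow> e \<in> cyc p \<Longrightarrow> e \<subseteq> set p"
  using pairs_subset by (fastforce simp: cyc_def)

lemma finite_pairs: "finite (pairs p)"
  by (induction p rule: pairs.induct) auto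

lemma finite_cyc: "finite (cyc p)"
  by (simp add: cyc_def finite_pairs)

lemma card_pairs_le: "card (pairs p) \<le> length p - 1"
proof (induction p rule: pairs.induct)
  case (1 x y zs)
  then show ?case by (auto simp: card_insert_if finite_pairs)
qed auto

lemma card_cyc_le: "p \<noteq> [] \<Longrightarrow> card (cyc p) \<le> length p"
  using card_pairs_le[of p] by (cases p) (auto simp: cyc_def card_insert_if finite_pairs)

lemma cyc_rev: "cyc (rev p) = cyc p"
  by (cases "p = []") (auto simp: cyc_def pairs_rev hd_rev last_rev insert_commute)

lemma cyc_append_commute: "cyc (xs @ ys) = cyc (ys @ xs)"
  by (cases "xs = []"; cases "ys = []") (auto simp: cyc_def pairs_append)

lemma pairs_conv_nth: "pairs p = (\<lambda>i. {p ! i, p ! Suc i}) ` {..<length p - 1}"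
proof (induction p rule: pairs.induct)
  case (1 x y zs)
  have "{..<length (x # y # zs) - 1} = insert 0 (Suc ` {..<length (y # zs) - 1})"
    by (simp add: lessThan_Suc_eq_insert_0)
  then show ?case using 1 by (simp add: image_image)
qed auto

lemma cyc_conv_nth:
  assumes "p \<noteq> []"
  shows "cyc p = (\<lambda>i. {p ! i, p ! (Suc i mod length p)}) ` {..<length p}"
proof -
  obtain m where m: "length p = Suc m" using assms by (cases p) auto
  have "{..<length p} = insert m {..<m}" using m by auto
  moreover have "(\<lambda>i. {p ! i, p ! (Suc i mod length p)}) ` {..<m} = pairs p"
    unfolding pairs_conv_nth using m by (intro image_cong) auto
  moreover have "{p ! m, p ! (Suc m mod length p)} = {last p, hd p}"
    using assms m by (simp add: last_conv_nth hd_conv_nth)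
  ultimately show ?thesis by (simp add: cyc_def)
qed

text \<open>
  This is why lists have length at least 3 below: the closing pair then leaves the cyclic order
  when the list is rotated.
\<close>

lemma closing_pair_not_in_pairs:
  assumes "distinct p" "length p \<ge> 3"
  shows "{last p, hd p} \<notin> pairs p"
proof
  assume "{last p, hd p} \<in> pairs p"
  then obtain i where i: "i < length p - 1" "{last p, hd p} = {p ! i, p ! Suc i}"
    by (auto simp: pairs_conv_nth)
  have l: "length p - 1 < length p" "i < length p" "Suc i < length p" "0 < length p" "p \<noteq> []"
    using assms i(1) by auto
  have eq: "{p ! (length p - 1), p ! 0} = {p ! i, p ! Suc i}"
    using i(2) l(5) by (simp add: last_conv_nth hd_conv_nth)
  have "p ! (length p - 1) \<noteq> p ! i"
    using nth_eq_iff_index_eq[OF assms(1) l(1,2)] i(1) by simp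
  then have "p ! (length p - 1) = p ! Suc i" "p ! 0 = p ! i"
    using eq unfolding doubleton_eq_iff by blast+
  then have "length p - 1 = Suc i" "0 = i"
    using nth_eq_iff_index_eq[OF assms(1) l(1,3)] nth_eq_iff_index_eq[OF assms(1) l(4,2)] by blast+
  then show False using assms(2) by simp
qed

lemma cyc_nbrs_subset:
  assumes "distinct p" "x \<in> set p"
  shows "\<exists>a b. {y. {x, y} \<in> cyc p} \<subseteq> {a, b}"
proof -
  obtain xs ys where p: "p = xs @ x # ys" using assms by (auto dest: split_list)
  have c: "cyc p = cyc (x # ys @ xs)" unfolding p by (subst cyc_append_commute) simp
  show ?thesis
  proof (cases "ys @ xs = []")
    case True
    then show ?thesis unfolding c by (auto simp: cyc_def doubleton_eq_iff)
  next
    case False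
    have "x \<notin> set (ys @ xs)" using assms p by auto
    then have "{x, y} \<notin> pairs (ys @ xs)" for y using pairs_subset by fastforce
    moreover have "cyc (x # ys @ xs) =
        insert {last (ys @ xs), x} (insert {x, hd (ys @ xs)} (pairs (ys @ xs)))"
      using False by (simp add: cyc_def pairs_Cons del: append_is_Nil_conv)
    ultimately have "{y. {x, y} \<in> cyc p} \<subseteq> {hd (ys @ xs), last (ys @ xs)}"
      unfolding c by (auto simp: doubleton_eq_iff)
    then show ?thesis by blast
  qed
qed

lemma card_cyc_nbrs:
  assumes "distinct p" "p \<noteq> []"
  shows "finite {y. {x, y} \<in> cyc p}" "card {y. {x, y} \<in> cyc p} \<le> 2"
proof -
  have "\<exists>a b. {y. {x, y} \<in> cyc p} \<subseteq> {a, b}"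
  proof (cases "x \<in> set p")
    case False
    then have "{y. {x, y} \<in> cyc p} = {}" using cyc_subset[OF assms(2)] by blast
    then show ?thesis by auto
  qed (use cyc_nbrs_subset assms in metis)
  then obtain a b where ab: "{y. {x, y} \<in> cyc p} \<subseteq> {a, b}" by blast
  then show "finite {y. {x, y} \<in> cyc p}" by (rule finite_subset) simp
  have "card {y. {x, y} \<in> cyc p} \<le> card {a, b}" using ab by (intro card_mono) auto
  also have "\<dots> \<le> 2" by (simp add: card_insert_if)
  finally show "card {y. {x, y} \<in> cyc p} \<le> 2" .
qed

text \<open>
  Any pair of a cyclic order can be made the closing pair, in either orientation: cut the list at
  the pair and reverse it if necessary. So rotations need to be studied only at closing pairs.
\<close>

lemma cyc_reclose:
  assumes "{v, u} \<in> cyc p" "distinct p" "p \<noteq> []"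
  shows "\<exists>q. cyc q = cyc p \<and> distinct q \<and> set q = set p \<and> last q = v \<and> hd q = u"
proof -
  have *: "\<exists>q. cyc q = cyc p \<and> distinct q \<and> set q = set p \<and> {last q, hd q} = {v, u}"
    using assms(1) unfolding cyc_def
  proof (elim insertE)
    assume "{v, u} = {last p, hd p}"
    then show "\<exists>q. insert {last q, hd q} (pairs q) = insert {last p, hd p} (pairs p) \<and> distinct q
      \<and> set q = set p \<and> {last q, hd q} = {v, u}"
      by (intro exI[of _ p]) (simp add: assms)
  next
    assume "{v, u} \<in> pairs p"
    then obtain i where i: "i < length p - 1" "{v, u} = {p ! i, p ! Suc i}"
      by (auto simp: pairs_conv_nth)
    let ?q = "drop (Suc i) p @ take (Suc i) p"
    have "cyc ?q = cyc p" by (metis append_take_drop_id cyc_append_commute)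
    moreover have "distinct (take (Suc i) p @ drop (Suc i) p)" "set (take (Suc i) p @ drop (Suc i) p) = set p"
      using assms(2) by simp_all
    then have "distinct ?q" "set ?q = set p"
      unfolding distinct_append set_append by blast+
    moreover have "last ?q = p ! i" "hd ?q = p ! Suc i"
      using i by (auto simp: hd_append hd_drop_conv_nth take_Suc_conv_app_nth)
    ultimately show "\<exists>q. insert {last q, hd q} (pairs q) = insert {last p, hd p} (pairs p) \<and> distinct q
      \<and> set q = set p \<and> {last q, hd q} = {v, u}"
      using i unfolding cyc_def by (intro exI[of _ ?q]) auto
  qed
  then obtain q where q: "cyc q = cyc p" "distinct q" "set q = set p" "{last q, hd q} = {v, u}" by blast
  have "q \<noteq> []" using q(3) assms(3) by auto
  show ?thesis
  proof (cases "last q = v \<and> hd q = u")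
    case False
    then have "last q = u" "hd q = v" using q(4) by (auto simp: doubleton_eq_iff)
    then show ?thesis using q \<open>q \<noteq> []\<close>
      by (intro exI[of _ "rev q"]) (auto simp: cyc_rev hd_rev last_rev)
  qed (use q in blast)
qed

definition gaps :: "'a set set \<Rightarrow> 'a list \<Rightarrow> 'a set set" where
  "gaps M p = cyc p - M"

definition gapdeg :: "'a set set \<Rightarrow> 'a list \<Rightarrow> 'a \<Rightarrow> nat" where
  "gapdeg M p v = card {e \<in> gaps M p. v \<in> e}"

lemma finite_gaps: "finite (gaps M p)"
  by (simp add: gaps_def finite_cyc)

lemma card_gaps_le: "p \<noteq> [] \<Longrightarrow> card (gaps M p) \<le> length p"
  by (metis card_cyc_le card_mono finite_cyc gaps_def Diff_subset order_trans)

lemma cyc_pair_other: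
  assumes "p \<noteq> []" "e \<in> cyc p" "v \<in> e"
  shows "\<exists>u. e = {v, u}"
  using assms by (auto simp: cyc_def pairs_conv_nth insert_commute)

lemma gapdeg_le_2:
  assumes "distinct p" "p \<noteq> []"
  shows "gapdeg M p v \<le> 2"
proof -
  have "{e \<in> gaps M p. v \<in> e} \<subseteq> (\<lambda>y. {v, y}) ` {y. {v, y} \<in> cyc p}"
    using cyc_pair_other[OF assms(2)] by (fastforce simp: gaps_def)
  then have "gapdeg M p v \<le> card {y. {v, y} \<in> cyc p}"
    unfolding gapdeg_def by (rule surj_card_le[OF card_cyc_nbrs(1)[OF assms]])
  then show ?thesis using card_cyc_nbrs[OF assms, of v] by linarith
qed

lemma rotation_props:
  assumes "distinct (xs @ x # ys)" "ys \<noteq> []"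
  shows "distinct (xs @ x # rev ys)" "set (xs @ x # rev ys) = set (xs @ x # ys)"
    "hd (xs @ x # rev ys) = hd (xs @ x # ys)" "last (xs @ x # rev ys) = hd ys"
    "last (xs @ x # ys) = last ys"
  using assms by (auto simp: hd_append last_rev)

lemma pairs_split: 
  "ys \<noteq> [] \<Longrightarrow> pairs (xs @ x # ys) = insert {x, hd ys} (pairs (xs @ [x]) \<union> pairs ys)"
  using pairs_append[of "xs @ [x]" ys] by simp

lemma pairs_rotation: 
  "ys \<noteq> [] \<Longrightarrow> pairs (xs @ x # rev ys) = insert {x, last ys} (pairs (xs @ [x]) \<union> pairs ys)"
  using pairs_split[of "rev ys" xs x] by (simp add: hd_rev pairs_rev)

text \<open>
  A rotation deletes the closing pair and \<open>{x, hd ys}\<close>, and it creates a new closing pair and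
  \<open>{x, last ys}\<close>. The last of these belongs to Maker, so only the new closing pair can be a new gap.
\<close>

lemma rotation_gaps:
  assumes d: "distinct (xs @ x # ys)" and ne: "ys \<noteq> []" and len: "length (xs @ x # ys) \<ge> 3"
    and M: "M \<subseteq> M'" "{last ys, x} \<in> M'"
  shows "gaps M' (xs @ x # rev ys) \<subseteq> insert {hd ys, hd (xs @ x # ys)}
    (gaps M (xs @ x # ys) - {{last ys, hd (xs @ x # ys)}} - {{x, hd ys}})"
proof -
  let ?p = "xs @ x # ys" and ?q = "xs @ x # rev ys"
  have "{last ?p, hd ?p} \<notin> pairs ?p" using closing_pair_not_in_pairs[OF d len] .
  moreover have "{x, hd ys} \<notin> pairs (xs @ [x])"
    using pairs_subset[of _ "xs @ [x]"] d ne by (fastforce simp: hd_in_set)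
  moreover have "{x, hd ys} \<notin> pairs ys"
    using pairs_subset[of _ ys] d ne by fastforce
  ultimately have "pairs ?q - {{x, last ys}} \<subseteq> cyc ?p - {{last ys, hd ?p}} - {{x, hd ys}}"
    unfolding pairs_rotation[OF ne] using ne by (auto simp: cyc_def pairs_split)
  moreover have "cyc ?q = insert {hd ys, hd ?p} (pairs ?q)"
    using rotation_props[OF d ne] by (simp add: cyc_def)
  ultimately show ?thesis unfolding gaps_def using M by (auto simp: insert_commute)
qed

text \<open>
  The accounting behind every move of Maker. Only the new last vertex \<open>hd ys\<close> can come to be at
  more gaps, since the first vertex exchanges one closing pair for the other. If the broken pair
  was a gap itself, then not even \<open>hd ys\<close> does, and two gaps have been merged.
\<close>

lemma rotation_gapdeg:
  assumes d: "distinct (xs @ x # ys)" and ne: "ys \<noteq> []" and len: "length (xs @ x # ys) \<ge> 3"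
    and M: "M \<subseteq> M'" "{last ys, x} \<in> M'"
    and gap: "{last ys, hd (xs @ x # ys)} \<in> gaps M (xs @ x # ys)"
  shows "w \<noteq> hd ys \<Longrightarrow> gapdeg M' (xs @ x # rev ys) w \<le> gapdeg M (xs @ x # ys) w"
    and "last ys \<noteq> hd ys \<Longrightarrow> gapdeg M' (xs @ x # rev ys) (last ys) < gapdeg M (xs @ x # ys) (last ys)"
    and "card (gaps M' (xs @ x # rev ys)) \<le> card (gaps M (xs @ x # ys))"
    and "{hd ys, hd (xs @ x # ys)} \<in> M' \<Longrightarrow> card (gaps M' (xs @ x # rev ys)) < card (gaps M (xs @ x # ys))"
    and "{x, hd ys} \<in> gaps M (xs @ x # ys) \<Longrightarrow> card (gaps M' (xs @ x # rev ys)) < card (gaps M (xs @ x # ys))"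
    and "{x, hd ys} \<in> gaps M (xs @ x # ys) \<Longrightarrow> gapdeg M' (xs @ x # rev ys) w \<le> gapdeg M (xs @ x # ys) w"
proof -
  let ?p = "xs @ x # ys" and ?q = "xs @ x # rev ys"
  let ?G = "gaps M ?p" and ?G' = "gaps M' ?q" and ?c = "{last ys, hd ?p}" and ?n = "{hd ys, hd ?p}"
  note sub = rotation_gaps[OF d ne len M]
  have closing: "?c \<notin> pairs ?p" using closing_pair_not_in_pairs[OF d len] ne by simp
  have neq: "{x, hd ys} \<noteq> ?c" using closing ne by (auto simp: pairs_split)
  have neq': "hd ?p \<noteq> last ys" using d ne by (cases xs) auto
  have fin: "finite {e \<in> gaps M p. w \<in> e}" for M p and w :: 'a by (simp add: finite_gaps)
  have "card ?G' \<le> card (insert ?n (?G - {?c}))"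
    using sub by (intro card_mono) (auto simp: finite_gaps)
  also have "\<dots> \<le> Suc (card (?G - {?c}))"
    by (rule card_insert_le_m1) auto
  also have "\<dots> = card ?G" by (rule card_Suc_Diff1) (use gap finite_gaps in auto)
  finally show "card ?G' \<le> card ?G" .
  {
    assume "{hd ys, hd ?p} \<in> M'"
    then have "?G' \<subseteq> ?G - {?c}" using sub by (auto simp: gaps_def)
    then show "card ?G' < card ?G"
      by (metis gap card_Diff1_less card_mono finite_Diff finite_gaps order_le_less_trans)
  }
  {
    assume w: "w \<noteq> hd ys"
    show "gapdeg M' ?q w \<le> gapdeg M ?p w"
    proof (cases "w = hd ?p")
      case False
      then have "{e \<in> ?G'. w \<in> e} \<subseteq> {e \<in> ?G. w \<in> e}" using sub w by auto
      then show ?thesis unfolding gapdeg_def by (intro card_mono fin)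
    next
      case True
      have "{e \<in> ?G'. w \<in> e} \<subseteq> insert ?n ({e \<in> ?G. w \<in> e} - {?c})" using sub by auto
      then have "gapdeg M' ?q w \<le> card (insert ?n ({e \<in> ?G. w \<in> e} - {?c}))"
        unfolding gapdeg_def by (intro card_mono) (auto simp: finite_gaps)
      also have "\<dots> \<le> Suc (card ({e \<in> ?G. w \<in> e} - {?c}))"
        by (rule card_insert_le_m1) auto
      also have "\<dots> = gapdeg M ?p w" unfolding gapdeg_def
        by (rule card_Suc_Diff1) (use gap True fin in auto)
      finally show ?thesis .
    qed
  }
  {
    assume "last ys \<noteq> hd ys"
    then have "{e \<in> ?G'. last ys \<in> e} \<subseteq> {e \<in> ?G. last ys \<in> e} - {?c}" using sub neq' by (auto simp: doubleton_eq_iff)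
    then have "gapdeg M' ?q (last ys) \<le> card ({e \<in> ?G. last ys \<in> e} - {?c})"
      unfolding gapdeg_def by (intro card_mono) (auto simp: finite_gaps)
    also have "\<dots> < gapdeg M ?p (last ys)" unfolding gapdeg_def
      by (rule card_Diff1_less) (use gap fin in auto)
    finally show "gapdeg M' ?q (last ys) < gapdeg M ?p (last ys)" .
  }
  {
    assume x: "{x, hd ys} \<in> ?G"
    have "card ?G' \<le> card (insert ?n (?G - {?c} - {{x, hd ys}}))"
      using sub by (intro card_mono) (auto simp: finite_gaps)
    also have "\<dots> \<le> Suc (card (?G - {?c} - {{x, hd ys}}))"
      by (rule card_insert_le_m1) (auto simp: finite_gaps)
    also have "\<dots> = card (?G - {?c})"
      by (rule card_Suc_Diff1) (use x neq finite_gaps in auto)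
    also have "\<dots> < card ?G" by (rule card_Diff1_less) (use gap finite_gaps in auto)
    finally show "card ?G' < card ?G" .
    show "gapdeg M' ?q w \<le> gapdeg M ?p w"
    proof (cases "w \<in> ?n")
      case False
      then have "{e \<in> ?G'. w \<in> e} \<subseteq> {e \<in> ?G. w \<in> e}" using sub by auto
      then show ?thesis unfolding gapdeg_def by (intro card_mono fin)
    next
      case True
      then obtain r where r: "r \<in> {?c, {x, hd ys}}" "w \<in> r" by auto
      have "{e \<in> ?G'. w \<in> e} \<subseteq> insert ?n ({e \<in> ?G. w \<in> e} - {r})" using sub r(1) by auto
      then have "gapdeg M' ?q w \<le> card (insert ?n ({e \<in> ?G. w \<in> e} - {r}))"
        unfolding gapdeg_def by (intro card_mono) (auto simp: finite_gaps)
      also have "\<dots> \<le> Suc (card ({e \<in> ?G. w \<in> e} - {r}))"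
        by (rule card_insert_le_m1) auto
      also have "\<dots> = gapdeg M ?p w" unfolding gapdeg_def
        by (rule card_Suc_Diff1) (use gap r x fin in auto)
      finally show ?thesis .
    qed
  }
qed

lemma nth_ne_last:
  assumes "distinct p" "Suc i < length p"
  shows "p ! i \<noteq> last p"
proof -
  have "last p = p ! (length p - 1)" using assms by (intro last_conv_nth) auto
  then show ?thesis using nth_eq_iff_index_eq[OF assms(1), of i "length p - 1"] assms by auto
qed

definition rotate_at :: "nat \<Rightarrow> 'a list \<Rightarrow> 'a list" where
  "rotate_at i p = take i p @ p ! i # rev (drop (Suc i) p)"

lemma gaps_cong: "cyc q = cyc p \<Longrightarrow> gaps M q = gaps M p"
  by (simp add: gaps_def)

lemma gapdeg_cong: "cyc q = cyc p \<Longrightarrow> gapdeg M q v = gapdeg M p v"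
  by (simp add: gapdeg_def gaps_def)

lemma gapdeg_antimono: 
  assumes "gaps M' q \<subseteq> gaps M p" shows "gapdeg M' q v \<le> gapdeg M p v"
  unfolding gapdeg_def by (intro card_mono) (use assms in \<open>auto simp: finite_gaps\<close>)

context
  fixes p :: "'a list" and i :: nat
  assumes d: "distinct p" and i: "Suc i < length p"
begin

lemma rotate_at_split:
  "p = take i p @ p ! i # drop (Suc i) p" "drop (Suc i) p \<noteq> []"
  "hd (drop (Suc i) p) = p ! Suc i" "last (drop (Suc i) p) = last p"
  using i by (auto simp: id_take_nth_drop[symmetric] hd_drop_conv_nth)

lemma rotate_at_props:
  "distinct (rotate_at i p)" "set (rotate_at i p) = set p" "hd (rotate_at i p) = hd p"
  "last (rotate_at i p) = p ! Suc i"
  using rotation_props[of "take i p" "p ! i" "drop (Suc i) p"] d rotate_at_split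
  by (simp_all add: rotate_at_def)

lemma pairs_rotate_at: "pairs (rotate_at i p) \<subseteq> insert {p ! i, last p} (pairs p)"
  using pairs_rotation[OF rotate_at_split(2), of "take i p" "p ! i"]
    pairs_split[OF rotate_at_split(2), of "take i p" "p ! i"] rotate_at_split
  by (auto simp: rotate_at_def)

lemma cyc_rotate_at:
  "cyc (rotate_at i p) \<subseteq> insert {p ! i, last p} (insert {p ! Suc i, hd p} (cyc p))"
  using pairs_rotate_at by (auto simp: cyc_def rotate_at_props)

lemma gaps_rotate_at:
  assumes "length p \<ge> 3" "M \<subseteq> M'" "{last p, p ! i} \<in> M'" "{last p, hd p} \<in> gaps M p"
  shows "w \<noteq> p ! Suc i \<Longrightarrow> gapdeg M' (rotate_at i p) w \<le> gapdeg M p w"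
    and "last p \<noteq> p ! Suc i \<Longrightarrow> gapdeg M' (rotate_at i p) (last p) < gapdeg M p (last p)"
    and "card (gaps M' (rotate_at i p)) \<le> card (gaps M p)"
    and "{p ! Suc i, hd p} \<in> M' \<Longrightarrow> card (gaps M' (rotate_at i p)) < card (gaps M p)"
    and "{p ! i, p ! Suc i} \<in> gaps M p \<Longrightarrow> card (gaps M' (rotate_at i p)) < card (gaps M p)"
    and "{p ! i, p ! Suc i} \<in> gaps M p \<Longrightarrow> gapdeg M' (rotate_at i p) w \<le> gapdeg M p w"
  using rotation_gapdeg[of "take i p" "p ! i" "drop (Suc i) p" M M'] assms d rotate_at_split
  by (simp_all add: rotate_at_def)

end

section \<open>A box game on Breaker's degrees\<close>

definition vdeg :: "'a set set \<Rightarrow> 'a \<Rightarrow> nat" where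
  "vdeg B v = card {e \<in> B. v \<in> e}"

definition touching :: "'a set set \<Rightarrow> 'a set \<Rightarrow> nat" where
  "touching B I = card {e \<in> B. e \<inter> I \<noteq> {}}"

lemma vdeg_mono: "finite B' \<Longrightarrow> B \<subseteq> B' \<Longrightarrow> vdeg B v \<le> vdeg B' v"
  unfolding vdeg_def by (intro card_mono) auto

lemma touching_le_sum_vdeg:
  assumes "finite B" "finite I"
  shows "touching B I \<le> (\<Sum>v\<in>I. vdeg B v)"
proof -
  have eq: "{e \<in> B. e \<inter> I \<noteq> {}} = (\<Union>v\<in>I. {e \<in> B. v \<in> e})" by blast
  show ?thesis unfolding touching_def vdeg_def eq by (rule card_UN_le[OF assms(2)])
qed

lemma touching_Un_le: "finite B \<Longrightarrow> finite X \<Longrightarrow> touching (B \<union> X) I \<le> touching B I + card X"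
proof -
  assume f: "finite B" "finite X"
  have "touching (B \<union> X) I \<le> card ({e \<in> B. e \<inter> I \<noteq> {}} \<union> X)"
    unfolding touching_def using f by (intro card_mono) auto
  also have "\<dots> \<le> touching B I + card X" unfolding touching_def by (rule card_Un_le)
  finally show ?thesis .
qed

text \<open>
  An edge that meets both \<open>I\<close> and \<open>m\<close> is \<open>{m, w}\<close> with \<open>w \<in> I\<close>, so at most \<open>card I\<close> edges are
  counted twice.
\<close>

lemma touching_insert_ge:
  assumes B: "finite B" "\<And>e. e \<in> B \<Longrightarrow> card e = 2" and I: "finite I" "m \<notin> I"
  shows "touching B I + vdeg B m \<le> touching B (insert m I) + card I"
proof -
  let ?a = "{e \<in> B. e \<inter> I \<noteq> {}}" and ?b = "{e \<in> B. m \<in> e}"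
  have "?a \<inter> ?b \<subseteq> (\<lambda>w. {m, w}) ` I"
  proof
    fix e assume e: "e \<in> ?a \<inter> ?b"
    then obtain w where w: "w \<in> e" "w \<in> I" by blast
    have "m \<noteq> w" using w I(2) by auto
    then have "{m, w} = e" using e w B(2)[of e]
      by (intro card_subset_eq) (auto intro: card_ge_0_finite)
    then show "e \<in> (\<lambda>w. {m, w}) ` I" using w by blast
  qed
  then have "card (?a \<inter> ?b) \<le> card I" by (rule surj_card_le[OF I(1)])
  moreover have "card (?a \<union> ?b) + card (?a \<inter> ?b) = card ?a + card ?b"
    using B(1) card_Un_Int[of ?a ?b] by simp
  moreover have "?a \<union> ?b = {e \<in> B. e \<inter> insert m I \<noteq> {}}" by auto
  ultimately show ?thesis unfolding touching_def vdeg_def by simp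
qed

lemma sum_vdeg:
  assumes B: "finite B" "\<And>e. e \<in> B \<Longrightarrow> card e = 2" and V: "finite V"
  shows "(\<Sum>v\<in>V. vdeg B v) \<le> 2 * card B"
proof -
  have "(\<Sum>v\<in>V. vdeg B v) = (\<Sum>v\<in>V. \<Sum>e\<in>B. if v \<in> e then 1 else 0)"
    unfolding vdeg_def by (intro sum.cong) (simp_all add: sum.If_cases B(1) Int_def)
  also have "\<dots> = (\<Sum>e\<in>B. \<Sum>v\<in>V. if v \<in> e then 1 else 0)" by (rule sum.swap)
  also have "\<dots> \<le> (\<Sum>e\<in>B. 2)"
  proof (intro sum_mono)
    fix e assume e: "e \<in> B"
    have "card (V \<inter> e) \<le> card e"
      using B(2)[OF e] by (intro card_mono) (auto intro: card_ge_0_finite)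
    then show "(\<Sum>v\<in>V. if v \<in> e then 1 else 0) \<le> (2::nat)"
      using B(2)[OF e] V by (simp add: sum.If_cases Int_def)
  qed
  finally show ?thesis by simp
qed

lemma card_high_vdeg:
  assumes B: "finite B" "\<And>e. e \<in> B \<Longrightarrow> card e = 2" and V: "finite V"
    and c: "card B \<le> N * \<tau>" and "\<tau> > 0"
  shows "card {v \<in> V. \<tau> \<le> vdeg B v} \<le> 2 * N"
proof -
  have "\<tau> * card {v \<in> V. \<tau> \<le> vdeg B v} = (\<Sum>v\<in>{v \<in> V. \<tau> \<le> vdeg B v}. \<tau>)" by simp
  also have "\<dots> \<le> (\<Sum>v\<in>{v \<in> V. \<tau> \<le> vdeg B v}. vdeg B v)" by (intro sum_mono) auto
  also have "\<dots> \<le> 2 * card B" by (rule sum_vdeg) (use assms in auto)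
  also have "\<dots> \<le> \<tau> * (2 * N)" using c by (simp add: mult.commute)
  finally show ?thesis using \<open>\<tau> > 0\<close> by simp
qed

text \<open>
  The average of Breaker's degrees that a set of \<open>i\<close> vertices at gaps may have. In the step from \<open>i + 1\<close> to
  \<open>i\<close> vertices Breaker's \<open>b\<close> edges are spread over \<open>i + 1\<close> vertices, and the summand 1 pays for
  edges inside the set, which contribute to two degrees.
\<close>

definition box_bound :: "nat \<Rightarrow> nat \<Rightarrow> nat \<Rightarrow> nat \<Rightarrow> real" where
  "box_bound b \<tau> N i = real \<tau> + (\<Sum>j\<in>{i<..N}. real b / real j + 1)"

text \<open>
  The number of gaps that a vertex has lost, but only for a vertex of degree at least \<open>\<tau>\<close>. Other
  vertices may still gain gaps; counting 0 for them makes this number monotone during the game.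
\<close>

definition treated :: "nat \<Rightarrow> ('a \<Rightarrow> nat) \<Rightarrow> ('a \<Rightarrow> nat) \<Rightarrow> 'a \<Rightarrow> nat" where
  "treated \<tau> deg g v = (if \<tau> \<le> deg v then 2 - g v else 0)"

text \<open>
  Two choices make this invariant sharp. Breaker's edges that meet \<open>I\<close> are counted once, instead of
  summing degrees, so that one of his moves adds \<open>b\<close> and not \<open>2 * b\<close>. And every gap removed at a
  vertex of \<open>I\<close> earns a credit of \<open>b\<close>, so that a vertex at two gaps can be treated twice without
  doubling the bound.
\<close>

definition box_inv :: "nat \<Rightarrow> nat \<Rightarrow> nat \<Rightarrow> 'a set \<Rightarrow> 'a set set \<Rightarrow> ('a \<Rightarrow> nat) \<Rightarrow> bool" where
  "box_inv b \<tau> N V B g \<longleftrightarrow> (\<forall>I. I \<subseteq> V \<longrightarrow> I \<noteq> {} \<longrightarrow> (\<forall>v\<in>I. \<tau> \<le> vdeg B v \<longrightarrow> 0 < g v) \<longrightarrow>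
     real (touching B I) \<le>
       real (card I) * box_bound b \<tau> N (card I) + real b * real (\<Sum>v\<in>I. treated \<tau> (vdeg B) g v))"

lemma box_bound_ge: "real \<tau> \<le> box_bound b \<tau> N i"
  unfolding box_bound_def by (simp add: sum_nonneg)

lemma box_bound_Suc:
  assumes "i < N"
  shows "box_bound b \<tau> N i = box_bound b \<tau> N (Suc i) + real b / real (Suc i) + 1"
proof -
  have "{i<..N} = insert (Suc i) {Suc i<..N}" using assms by auto
  then show ?thesis unfolding box_bound_def by simp
qed

lemma treated_mono:
  assumes "deg v \<le> deg' v" "\<tau> \<le> deg' v \<Longrightarrow> g' v \<le> g v"
  shows "treated \<tau> deg g v \<le> treated \<tau> deg' g' v"
  using assms by (auto simp: treated_def)

lemma box_inv_init: "box_inv b \<tau> N V {} g"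
proof -
  have "0 \<le> box_bound b \<tau> N i" for i using box_bound_ge[of \<tau> b N i] by linarith
  then show ?thesis unfolding box_inv_def touching_def
    by (simp add: add_nonneg_nonneg sum_nonneg)
qed

text \<open>
  Let \<open>m\<close> be the vertex treated after Breaker's move \<open>X\<close>. If \<open>m \<in> I\<close>, the credit for \<open>m\<close> pays for \<open>X\<close>.
  If \<open>m \<notin> I\<close>, the old bound for \<open>insert m I\<close> yields the new one for \<open>I\<close>, because \<open>m\<close> has at
  least the average danger of \<open>I\<close> and so carries its share of the edges away. Two cases are
  trivial: if the average danger of \<open>I\<close> is at most \<open>\<tau>\<close>, and if \<open>I\<close> has at least \<open>N\<close> vertices, since
  there are at most \<open>N * \<tau>\<close> edges.
\<close>

lemma box_inv_step:
  assumes V: "finite V" and B: "finite B" "finite X" "\<And>e. e \<in> B \<union> X \<Longrightarrow> card e = 2" "card X \<le> b"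
    and size: "card (B \<union> X) \<le> N * \<tau>"
    and inv: "box_inv b \<tau> N V B g"
    and mono: "\<And>v. v \<in> V \<Longrightarrow> \<tau> \<le> vdeg (B \<union> X) v \<Longrightarrow> g' v \<le> g v" and g2: "\<And>v. v \<in> V \<Longrightarrow> g v \<le> 2"
    and treat: "(\<forall>v\<in>V. \<tau> \<le> vdeg (B \<union> X) v \<longrightarrow> g v = 0) \<or>
      (\<exists>m\<in>V. \<tau> \<le> vdeg (B \<union> X) m \<and> g' m < g m \<and>
        (\<forall>v\<in>V. \<tau> \<le> vdeg (B \<union> X) v \<longrightarrow> 0 < g v \<longrightarrow>
          real (vdeg (B \<union> X) v) - real b * real (treated \<tau> (vdeg (B \<union> X)) g v) \<le>
          real (vdeg (B \<union> X) m) - real b * real (treated \<tau> (vdeg (B \<union> X)) g m)))"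
  shows "box_inv b \<tau> N V (B \<union> X) g'"
  unfolding box_inv_def
proof (intro allI impI)
  fix I assume I: "I \<subseteq> V" "I \<noteq> {}" "\<forall>v\<in>I. \<tau> \<le> vdeg (B \<union> X) v \<longrightarrow> 0 < g' v"
  let ?B = "B \<union> X" and ?F = "box_bound b \<tau> N"
  let ?co = "treated \<tau> (vdeg B) g" and ?c = "treated \<tau> (vdeg ?B) g" and ?c' = "treated \<tau> (vdeg ?B) g'"
  define dng where "dng v = real (vdeg ?B v) - real b * real (?c v)" for v
  have fB: "finite ?B" using B by simp
  have fI: "finite I" using I V by (auto intro: finite_subset)
  have i0: "card I > 0" using fI I by (simp add: card_gt_0_iff)
  have cc': "?c v \<le> ?c' v" if "v \<in> V" for v
    using mono[OF that] by (intro treated_mono) auto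
  have c0c: "?co v \<le> ?c v" for v
    using vdeg_mono[OF fB, of B v] by (intro treated_mono) auto
  have sum_c: "real (touching ?B I) \<le> real (card I) * ?F (card I) + real b * real (\<Sum>v\<in>I. ?c v) \<Longrightarrow>
     real (touching ?B I) \<le> real (card I) * ?F (card I) + real b * real (\<Sum>v\<in>I. ?c' v)"
  proof -
    have "(\<Sum>v\<in>I. ?c v) \<le> (\<Sum>v\<in>I. ?c' v)" using I cc' by (intro sum_mono) auto
    then have "real b * real (\<Sum>v\<in>I. ?c v) \<le> real b * real (\<Sum>v\<in>I. ?c' v)"
      by (intro mult_left_mono) linarith+
    then show "real (touching ?B I) \<le> real (card I) * ?F (card I) + real b * real (\<Sum>v\<in>I. ?c v) \<Longrightarrow>
      ?thesis" by linarith
  qed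
  have old: "real (touching B J) \<le> real (card J) * ?F (card J) + real b * real (\<Sum>v\<in>J. ?co v)"
    if "J \<subseteq> V" "J \<noteq> {}" "\<forall>v\<in>J. \<tau> \<le> vdeg ?B v \<longrightarrow> 0 < g v" for J
  proof -
    have "\<forall>v\<in>J. \<tau> \<le> vdeg B v \<longrightarrow> 0 < g v"
    proof (intro ballI impI)
      fix v assume "v \<in> J" "\<tau> \<le> vdeg B v"
      moreover have "vdeg B v \<le> vdeg ?B v" by (rule vdeg_mono[OF fB Un_upper1])
      ultimately show "0 < g v" using that(3) by simp
    qed
    then show ?thesis using inv[unfolded box_inv_def, rule_format, OF that(1,2)] by blast
  qed
  have Ig: "\<forall>v\<in>I. \<tau> \<le> vdeg ?B v \<longrightarrow> 0 < g v" using I(1,3) mono by (meson less_le_trans subsetD)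
  have tI: "real (card I) * real \<tau> \<le> real (card I) * ?F (card I)"
    by (intro mult_left_mono box_bound_ge) simp
  have sig: "real (touching ?B I) - real b * real (\<Sum>v\<in>I. ?c v) \<le> (\<Sum>v\<in>I. dng v)"
  proof -
    have "real (touching ?B I) \<le> real (\<Sum>v\<in>I. vdeg ?B v)"
      using touching_le_sum_vdeg[OF fB fI] by linarith
    then show ?thesis by (simp add: dng_def sum_subtractf sum_distrib_left)
  qed
  show "real (touching ?B I) \<le> real (card I) * ?F (card I) + real b * real (\<Sum>v\<in>I. ?c' v)"
  proof (cases "(\<Sum>v\<in>I. dng v) \<le> real (card I) * real \<tau>")
    case True
    then show ?thesis using sum_c sig tI by linarith
  next
    case False
    have "\<exists>v\<in>I. dng v > real \<tau>"
    proof (rule ccontr)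
      assume "\<not> ?thesis"
      then have "\<And>v. v \<in> I \<Longrightarrow> dng v \<le> real \<tau>" by (simp add: not_less)
      then show False using False sum_bounded_above[of I dng "real \<tau>"] by blast
    qed
    then obtain v where v: "v \<in> I" "dng v > real \<tau>" by blast
    have "dng v \<le> real (vdeg ?B v)" unfolding dng_def by simp
    then have dv: "\<tau> \<le> vdeg ?B v" using v(2) by linarith
    have "g v \<noteq> 0" using Ig[rule_format, OF v(1) dv] by simp
    then obtain m where m: "m \<in> V" "\<tau> \<le> vdeg ?B m" "g' m < g m"
      "\<And>v. v \<in> V \<Longrightarrow> \<tau> \<le> vdeg ?B v \<Longrightarrow> 0 < g v \<Longrightarrow> dng v \<le> dng m"
    proof -
      have "\<not> (\<forall>v\<in>V. \<tau> \<le> vdeg ?B v \<longrightarrow> g v = 0)" using v(1) dv I(1) \<open>g v \<noteq> 0\<close> by auto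
      then show ?thesis using treat that unfolding dng_def by auto
    qed
    have dm: "real \<tau> < dng m" using m(4)[OF subsetD[OF I(1) v(1)] dv] v(2) \<open>g v \<noteq> 0\<close> by simp
    show ?thesis
    proof (cases "m \<in> I")
      case mI: True
      have "real (touching ?B I) \<le> real (touching B I) + real b"
        using touching_Un_le[OF B(1,2), of I] B(4) by linarith
      moreover have "(\<Sum>v\<in>I. ?co v) + 1 \<le> (\<Sum>v\<in>I. ?c' v)"
      proof -
        have "?c m + 1 \<le> ?c' m" using m g2[OF m(1)] by (simp add: treated_def)
        moreover have "(\<Sum>v\<in>I - {m}. ?co v) \<le> (\<Sum>v\<in>I - {m}. ?c' v)"
        proof (rule sum_mono)
          fix v assume "v \<in> I - {m}"
          then show "?co v \<le> ?c' v" using c0c[of v] cc'[of v] I(1) by auto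
        qed
        ultimately show ?thesis
          using c0c[of m] sum.remove[OF fI mI, of ?co] sum.remove[OF fI mI, of ?c'] by linarith
      qed
      then have "real b * real (\<Sum>v\<in>I. ?co v) + real b \<le> real b * real (\<Sum>v\<in>I. ?c' v)"
        using mult_left_mono[of "real ((\<Sum>v\<in>I. ?co v) + 1)" "real (\<Sum>v\<in>I. ?c' v)" "real b"]
        by (simp add: distrib_left del: of_nat_sum)
      ultimately show ?thesis using old[OF I(1,2) Ig] by linarith
    next
      case mI: False
      let ?i = "card I" and ?J = "insert m I"
      show ?thesis
      proof (cases "N \<le> ?i")
        case True
        have "touching ?B I \<le> card ?B" unfolding touching_def using fB by (intro card_mono) auto
        also have "\<dots> \<le> ?i * \<tau>" using size True by (meson le_trans mult_le_mono1)
        finally have "real (touching ?B I) \<le> real ?i * real \<tau>" by (metis of_nat_le_iff of_nat_mult)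
        moreover have "0 \<le> real b * real (\<Sum>v\<in>I. ?c' v)"
          by (intro mult_nonneg_nonneg of_nat_0_le_iff)
        ultimately show ?thesis using tI by linarith
      next
        case iN: False
        have cJ: "card ?J = Suc ?i" using fI mI by simp
        have "real (touching B ?J) \<le> real (card ?J) * ?F (card ?J) + real b * real (\<Sum>v\<in>?J. ?co v)"
          by (rule old) (use I m Ig in auto)
        moreover have "(\<Sum>v\<in>?J. ?co v) \<le> (\<Sum>v\<in>?J. ?c v)" by (intro sum_mono c0c)
        then have "real b * real (\<Sum>v\<in>?J. ?co v) \<le> real b * real (\<Sum>v\<in>?J. ?c v)"
          by (intro mult_left_mono) linarith+
        moreover have "real (touching ?B ?J) \<le> real (touching B ?J) + real b"
          using touching_Un_le[OF B(1,2), of ?J] B(4) by linarith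
        moreover have "real (touching ?B I) + real (vdeg ?B m) \<le> real (touching ?B ?J) + real ?i"
          using touching_insert_ge[OF fB B(3) fI mI] by linarith
        moreover have "real b * real (\<Sum>v\<in>?J. ?c v) = real b * real (?c m) + real b * real (\<Sum>v\<in>I. ?c v)"
          using fI mI by (simp add: algebra_simps)
        moreover define \<sigma> where "\<sigma> = real (touching ?B I) - real b * real (\<Sum>v\<in>I. ?c v)"
        ultimately have 1: "\<sigma> + dng m \<le> real (Suc ?i) * ?F (Suc ?i) + real b + real ?i"
          unfolding dng_def cJ by linarith
        have "\<sigma> \<le> (\<Sum>v\<in>I. dng v)" using sig by (simp add: \<sigma>_def)
        also have "\<dots> \<le> (\<Sum>v\<in>I. dng m)"
        proof (intro sum_mono)
          fix v assume v: "v \<in> I"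
          show "dng v \<le> dng m"
          proof (cases "\<tau> \<le> vdeg ?B v")
            case True
            then show ?thesis using m(4)[OF subsetD[OF I(1) v]] Ig v by simp
          next
            case False
            have "dng v \<le> real (vdeg ?B v)" unfolding dng_def by simp
            then show ?thesis using dm False by linarith
          qed
        qed
        finally have 2: "\<sigma> \<le> real ?i * dng m" by simp
        have "\<sigma> * real (Suc ?i) = real ?i * \<sigma> + \<sigma>" by (simp add: algebra_simps)
        also have "\<dots> \<le> real ?i * (\<sigma> + dng m)" using 2 by (simp add: algebra_simps)
        also have "\<dots> \<le> real ?i * (real (Suc ?i) * ?F (Suc ?i) + real b + real ?i)"
          using 1 by (intro mult_left_mono) auto
        also have "\<dots> \<le> real ?i * (real (Suc ?i) * ?F ?i)"
          using box_bound_Suc[of ?i N b \<tau>] iN by (intro mult_left_mono) (auto simp: field_simps)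
        finally have "\<sigma> * real (Suc ?i) \<le> (real ?i * ?F ?i) * real (Suc ?i)" by (simp add: algebra_simps)
        then have "\<sigma> \<le> real ?i * ?F ?i"
          by (rule mult_right_le_imp_le) simp
        then show ?thesis using sum_c unfolding \<sigma>_def by linarith
      qed
    qed
  qed
qed

lemma sum_inverse_le_ln:
  assumes "1 \<le> N" shows "(\<Sum>j\<in>{1<..N}. 1 / real j) \<le> ln (real N)"
  using assms
proof (induction N rule: dec_induct)
  case (step N)
  have "{1<..Suc N} = insert (Suc N) {1<..N}" using step by auto
  then have "(\<Sum>j\<in>{1<..Suc N}. 1 / real j) \<le> 1 / real (Suc N) + ln (real N)" using step by simp
  also have "1 / real (Suc N) \<le> ln (real (Suc N)) - ln (real N)"
  proof -
    have "ln (real N / real (Suc N)) \<le> real N / real (Suc N) - 1"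
      using step by (intro ln_le_minus_one) auto
    then show ?thesis using step by (simp add: ln_div field_simps)
  qed
  finally show ?case by simp
qed simp

text \<open>
  For a single vertex the bound is a harmonic sum, hence the logarithm.
\<close>

lemma box_inv_degree:
  assumes inv: "box_inv b \<tau> N V B g" and X: "finite B" "finite X" "card X \<le> b"
    and m: "m \<in> V" "0 < g m" and N: "1 \<le> N"
  shows "real (vdeg (B \<union> X) m) \<le> real \<tau> + real b * ln (real N) + real N + 2 * real b"
proof -
  have t: "touching B {m} = vdeg B m" for B by (simp add: touching_def vdeg_def)
  have "real (touching B {m}) \<le> real (card {m}) * box_bound b \<tau> N (card {m}) +
      real b * real (\<Sum>v\<in>{m}. treated \<tau> (vdeg B) g v)"
    by (rule inv[unfolded box_inv_def, rule_format]) (use m in auto)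
  moreover have "real b * real (treated \<tau> (vdeg B) g m) \<le> real b * 1"
    using m by (intro mult_left_mono) (auto simp: treated_def)
  moreover have "box_bound b \<tau> N 1 = real \<tau> + (real b * (\<Sum>j\<in>{1<..N}. 1 / real j) + real (N - 1))"
    unfolding box_bound_def sum.distrib by (simp add: sum_distrib_left)
  moreover have "real b * (\<Sum>j\<in>{1<..N}. 1 / real j) \<le> real b * ln (real N)"
    by (intro mult_left_mono sum_inverse_le_ln N) simp
  moreover have "vdeg (B \<union> X) m \<le> vdeg B m + b"
    using touching_Un_le[OF X(1,2), of "{m}"] X(3) by (simp add: t)
  ultimately show ?thesis using t[of B] by simp
qed

lemma card_partners_le:
  assumes "finite B"
  shows "card {r \<in> S. {u, r} \<in> B} \<le> vdeg B u"
proof -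
  have "card {r \<in> S. {u, r} \<in> B} = card ((\<lambda>r. {u, r}) ` {r \<in> S. {u, r} \<in> B})"
    by (intro card_image[symmetric]) (auto simp: inj_on_def doubleton_eq_iff)
  also have "\<dots> \<le> vdeg B u" unfolding vdeg_def using assms by (intro card_mono) auto
  finally show ?thesis .
qed

lemma exists_free_partner:
  assumes "finite B" "vdeg B u < card S"
  shows "\<exists>r\<in>S. {u, r} \<notin> B"
proof (rule ccontr)
  assume "\<not> ?thesis"
  then have "{r \<in> S. {u, r} \<in> B} = S" by auto
  then show False using card_partners_le[OF assms(1), of S u] assms(2) by simp
qed

section \<open>A potential function for expansion\<close>

text \<open>
  From \<open>k ^ k / fact k \<le> exp k \<le> 3 ^ k\<close>.
\<close>

lemma binomial_le_power:
  assumes "0 < k" shows "real (m choose k) \<le> (3 * real m / real k) ^ k"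
proof -
  have "real k ^ k / fact k \<le> exp (real k)"
  proof -
    have "(\<Sum>n\<in>{k}. real k ^ n /\<^sub>R fact n) \<le> exp (real k)"
      unfolding exp_def by (rule sum_le_suminf) (auto intro: summable_exp)
    then show ?thesis by (simp add: divide_inverse mult.commute)
  qed
  also have "exp (real k) \<le> 3 ^ k"
  proof -
    have "exp (1::real) ^ k \<le> 3 ^ k" by (intro power_mono) (use exp_le in auto)
    then show ?thesis by (simp add: exp_of_nat_mult[symmetric])
  qed
  finally have f: "real k ^ k \<le> 3 ^ k * fact k" by (simp add: field_simps)
  have "real (m choose k) * fact k \<le> real m ^ k"
    using binomial_fact_pow[of m k] by (metis of_nat_fact of_nat_le_iff of_nat_mult of_nat_power)
  then have "real (m choose k) * fact k * real k ^ k \<le> real m ^ k * (3 ^ k * fact k)"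
    using f by (intro mult_mono) auto
  then have "real (m choose k) * real k ^ k \<le> (3 * real m) ^ k"
    by (simp add: power_mult_distrib mult_ac)
  then show ?thesis using assms by (simp add: power_divide field_simps)
qed

text \<open>
  A trap is a pair \<open>(Y, S)\<close> with \<open>card S = 6 * card Y\<close>; it closes if all edges from \<open>Y\<close> end in \<open>S\<close>. The
  weight bounds the conditional probability that this happens if each of the missing edges of \<open>Y\<close>
  (out of \<open>d\<close> per vertex) goes to a random one of at least \<open>t / 2\<close> targets: one edge hits \<open>S\<close> with
  probability at most \<open>12 * card Y / t\<close>.
\<close>

definition trap_weight :: "nat \<Rightarrow> nat \<Rightarrow> ('a \<times> 'a) set \<Rightarrow> 'a set \<Rightarrow> 'a set \<Rightarrow> real" where
  "trap_weight t d out Y S = (if out `` Y \<subseteq> S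
     then (12 * real (card Y) / real t) ^ (\<Sum>a\<in>Y. d - card (out `` {a})) else 0)"

definition traps :: "nat \<Rightarrow> 'a set \<Rightarrow> 'a set \<Rightarrow> ('a set \<times> 'a set) set" where
  "traps s A T = {(Y, S). Y \<subseteq> A \<and> Y \<noteq> {} \<and> card Y \<le> s \<and> S \<subseteq> T \<and> card S = 6 * card Y}"

definition trap_potential :: "nat \<Rightarrow> nat \<Rightarrow> nat \<Rightarrow> 'a set \<Rightarrow> 'a set \<Rightarrow> ('a \<times> 'a) set \<Rightarrow> real" where
  "trap_potential t d s A T out = (\<Sum>(Y, S)\<in>traps s A T. trap_weight t d out Y S)"

lemma finite_traps: "finite A \<Longrightarrow> finite T \<Longrightarrow> finite (traps s A T)"
  by (rule finite_subset[of _ "Pow A \<times> Pow T"]) (auto simp: traps_def)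

lemma trap_weight_nonneg: "0 \<le> trap_weight t d out Y S"
  by (simp add: trap_weight_def)

lemma trap_weight_insert:
  assumes a: "a \<in> Y" "finite Y" and out: "finite (out `` {a})" "card (out `` {a}) < d" and t: "0 < t"
    and x: "x \<notin> out `` {a}"
  shows "trap_weight t d (insert (a, x) out) Y S =
    (if x \<in> S then trap_weight t d out Y S / (12 * real (card Y) / real t) else 0)"
proof -
  let ?o = "insert (a, x) out" and ?q = "12 * real (card Y) / real t"
  have q: "?q \<noteq> 0" using a t by auto
  have im: "?o `` Y = insert x (out `` Y)" using a by auto
  have "?o `` {a} = insert x (out `` {a})" by auto
  then have ca: "card (?o `` {a}) = Suc (card (out `` {a}))" using x out by simp
  have "(\<Sum>a\<in>Y - {a}. d - card (?o `` {a})) = (\<Sum>a\<in>Y - {a}. d - card (out `` {a}))"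
    by (intro sum.cong arg_cong[where f = "\<lambda>z. d - card z"]) auto
  then have "(\<Sum>a\<in>Y. d - card (out `` {a})) = Suc (\<Sum>a\<in>Y. d - card (?o `` {a}))"
    using sum.remove[OF a(2,1), of "\<lambda>a. d - card (out `` {a})"]
      sum.remove[OF a(2,1), of "\<lambda>a. d - card (?o `` {a})"] ca out(2) by simp
  then show ?thesis unfolding trap_weight_def im using q by auto
qed

lemma trap_weight_insert_other:
  assumes "a \<notin> Y"
  shows "trap_weight t d (insert (a, x) out) Y S = trap_weight t d out Y S"
proof -
  have "insert (a, x) out `` Y = out `` Y" using assms by auto
  moreover have "(\<Sum>a'\<in>Y. d - card (insert (a, x) out `` {a'})) = (\<Sum>a'\<in>Y. d - card (out `` {a'}))"
    using assms by (intro sum.cong arg_cong[where f = "\<lambda>z. d - card z"]) auto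
  ultimately show ?thesis by (simp add: trap_weight_def)
qed

text \<open>
  The method of conditional probabilities: averaged over the available targets \<open>x\<close>, no weight
  increases, so some \<open>x\<close> does not increase their sum.
\<close>

lemma trap_potential_extend:
  assumes fin: "finite A" "finite T" and t: "0 < t"
    and a: "finite (out `` {a})" "card (out `` {a}) < d"
    and X: "X \<subseteq> T" "X \<inter> out `` {a} = {}" "real t \<le> 2 * real (card X)"
  shows "\<exists>x\<in>X. trap_potential t d s A T (insert (a, x) out) \<le> trap_potential t d s A T out"
proof -
  have fX: "finite X" using X fin by (auto intro: finite_subset)
  have Xne: "card X > 0" using X t by linarith
  have each: "(\<Sum>x\<in>X. trap_weight t d (insert (a, x) out) Y S) \<le> real (card X) * trap_weight t d out Y S"
    if YS: "(Y, S) \<in> traps s A T" for Y S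
  proof (cases "a \<in> Y")
    case False
    then show ?thesis by (simp add: trap_weight_insert_other)
  next
    case True
    have Y: "finite Y" "finite S" "card S = 6 * card Y"
      using YS fin by (auto simp: traps_def intro: finite_subset)
    let ?q = "12 * real (card Y) / real t" and ?w = "trap_weight t d out Y S"
    have y0: "0 < card Y" using True Y by (auto simp: card_gt_0_iff)
    have "(\<Sum>x\<in>X. trap_weight t d (insert (a, x) out) Y S) = (\<Sum>x\<in>X. if x \<in> S then ?w / ?q else 0)"
      using X(2) by (intro sum.cong trap_weight_insert[OF True Y(1) a t]) auto
    also have "\<dots> = real (card (X \<inter> S)) * (?w / ?q)" using fX by (simp add: sum.If_cases)
    also have "\<dots> \<le> real (6 * card Y) * (?w / ?q)"
      using Y card_mono[OF Y(2), of "X \<inter> S"] trap_weight_nonneg[of t d out Y S]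
      by (intro mult_right_mono) (auto intro!: divide_nonneg_nonneg)
    also have "\<dots> = (real t / 2) * ?w" using y0 t by (simp add: field_simps)
    also have "\<dots> \<le> real (card X) * ?w"
      using X(3) trap_weight_nonneg[of t d out Y S] by (intro mult_right_mono) auto
    finally show ?thesis .
  qed
  have "(\<Sum>x\<in>X. trap_potential t d s A T (insert (a, x) out)) =
      (\<Sum>(Y, S)\<in>traps s A T. \<Sum>x\<in>X. trap_weight t d (insert (a, x) out) Y S)"
    unfolding trap_potential_def case_prod_unfold by (rule sum.swap)
  also have "\<dots> \<le> (\<Sum>(Y, S)\<in>traps s A T. real (card X) * trap_weight t d out Y S)"
    by (intro sum_mono) (use each in auto)
  also have "\<dots> = real (card X) * trap_potential t d s A T out"
    by (simp add: trap_potential_def sum_distrib_left case_prod_unfold)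
  finally have le: "(\<Sum>x\<in>X. trap_potential t d s A T (insert (a, x) out)) \<le>
      real (card X) * trap_potential t d s A T out" .
  show ?thesis
  proof (rule ccontr)
    assume "\<not> ?thesis"
    then have "\<And>x. x \<in> X \<Longrightarrow> trap_potential t d s A T out < trap_potential t d s A T (insert (a, x) out)"
      by (simp add: not_le)
    then have "(\<Sum>x\<in>X. trap_potential t d s A T out) < (\<Sum>x\<in>X. trap_potential t d s A T (insert (a, x) out))"
      using Xne fX by (intro sum_strict_mono) auto
    then show False using le by simp
  qed
qed

text \<open>
  A set \<open>Y\<close> that has all its edges but few neighbours lies in a closed trap, and a closed trap
  without missing edges has weight 1.
\<close>

lemma trap_potential_expansion:
  assumes fin: "finite A" "finite T" and pot: "trap_potential t d s A T out < 1"
    and out: "out \<subseteq> A \<times> T" and Y: "Y \<subseteq> A" "Y \<noteq> {}" "card Y \<le> s" "6 * s \<le> card T"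
    and full: "\<And>a. a \<in> Y \<Longrightarrow> d \<le> card (out `` {a})"
  shows "6 * card Y < card (\<Union> ((\<lambda>a. out `` {a}) ` Y))"
proof (rule ccontr)
  have eq: "\<Union> ((\<lambda>a. out `` {a}) ` Y) = out `` Y" by auto
  assume "\<not> ?thesis"
  then have "card (out `` Y) \<le> 6 * card Y" by (simp add: eq)
  moreover have "out `` Y \<subseteq> T" using out by auto
  ultimately obtain S where S: "out `` Y \<subseteq> S" "S \<subseteq> T" "card S = 6 * card Y"
    using exists_subset_between[of "out `` Y" "6 * card Y" T] Y fin by auto
  have "(\<Sum>a\<in>Y. d - card (out `` {a})) = 0" using full by (intro sum.neutral) auto
  then have "trap_weight t d out Y S = 1" using S by (simp add: trap_weight_def)
  moreover have "(Y, S) \<in> traps s A T" using S Y by (auto simp: traps_def)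
  moreover have "(\<Sum>(Y, S)\<in>{(Y, S)}. trap_weight t d out Y S) \<le> trap_potential t d s A T out"
    unfolding trap_potential_def using calculation finite_traps[OF fin]
    by (intro sum_mono2) (auto simp: trap_weight_nonneg)
  ultimately show False using pot by simp
qed

text \<open>
  The union bound. With \<open>r = y / t\<close>, there are at most \<open>(6 / r) ^ y * (1 / r) ^ (6 * y)\<close> traps with
  \<open>card Y = y\<close>, each of weight \<open>(12 * r) ^ (9 * y)\<close>. Nine edges per vertex leave a factor \<open>r ^ (2 * y)\<close>,
  which for \<open>r \<le> 1 / 10 ^ 6\<close> makes the sum geometric.
\<close>

lemma trap_potential_init:
  assumes fin: "finite A" "finite T" and c: "card T = t" "card A = t + 1" and st: "10 ^ 6 * s \<le> t" "0 < t"
  shows "trap_potential t 9 s A T {} < 1"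
proof -
  have bound: "real ((t + 1) choose y) * real (t choose (6 * y)) * (12 * real y / real t) ^ (9 * y) \<le> (1 / 4) ^ y"
    if y: "y \<in> {1..s}" for y
  proof -
    let ?r = "real y / real t"
    have y0: "0 < y" using y by auto
    have r: "0 < ?r" "?r \<le> 1 / 10 ^ 6"
    proof -
      have "10 ^ 6 * y \<le> t" using y st by (meson atLeastAtMost_iff mult_le_mono2 order_trans)
      then have "10 ^ 6 * real y \<le> real t" by (metis of_nat_le_iff of_nat_mult of_nat_numeral of_nat_power)
      then show "?r \<le> 1 / 10 ^ 6" using st(2) by (simp add: field_simps)
    qed (use y0 st in auto)
    have "real ((t + 1) choose y) \<le> (3 * real (t + 1) / real y) ^ y" by (rule binomial_le_power[OF y0])
    also have "\<dots> \<le> (6 / ?r) ^ y"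
    proof (intro power_mono)
      have "real (t + 1) \<le> 2 * real t" using st(2) by linarith
      then show "3 * real (t + 1) / real y \<le> 6 / ?r" using y0 st(2) by (simp add: field_simps)
    qed auto
    finally have 1: "real ((t + 1) choose y) \<le> (6 / ?r) ^ y" .
    have "real (t choose (6 * y)) \<le> (3 * real t / real (6 * y)) ^ (6 * y)"
      by (rule binomial_le_power) (use y0 in simp)
    also have "\<dots> \<le> (1 / ?r) ^ (6 * y)" using y0 st(2) by (intro power_mono) (auto simp: field_simps)
    finally have 2: "real (t choose (6 * y)) \<le> ((1 / ?r) ^ 6) ^ y" by (simp add: power_mult)
    have 3: "(12 * real y / real t) ^ (9 * y) = ((12 * ?r) ^ 9) ^ y" by (simp add: power_mult)
    have "real ((t + 1) choose y) * real (t choose (6 * y)) * (12 * real y / real t) ^ (9 * y)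
        \<le> (6 / ?r) ^ y * ((1 / ?r) ^ 6) ^ y * ((12 * ?r) ^ 9) ^ y"
      unfolding 3 using 1 2 r by (intro mult_mono) auto
    also have "\<dots> = ((6 / ?r) * (1 / ?r) ^ 6 * (12 * ?r) ^ 9) ^ y" by (simp only: power_mult_distrib)
    also have "(6 / ?r) * (1 / ?r) ^ 6 * (12 * ?r) ^ 9 = 6 * 12 ^ 9 * ?r ^ 2"
    proof -
      have "(6 / z) * (1 / z) ^ 6 * (12 * z) ^ 9 = 6 * 12 ^ 9 * z ^ 2" if "z \<noteq> 0" for z :: real
      proof -
        have z9: "z ^ 9 = z ^ 2 * (z * z ^ 6)" by (simp add: eval_nat_numeral)
        have cancel: "(6 / z) * (1 / w) * (c * (z ^ 2 * (z * w))) = 6 * c * z ^ 2" if "w \<noteq> 0" for w c :: real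
          using that \<open>z \<noteq> 0\<close> by (simp add: field_simps)
        have "(6 / z) * (1 / z) ^ 6 * (12 * z) ^ 9 = (6 / z) * (1 / z ^ 6) * (12 ^ 9 * (z ^ 2 * (z * z ^ 6)))"
          by (simp only: power_mult_distrib power_divide power_one z9)
        then show ?thesis using cancel[of "z ^ 6" "12 ^ 9"] that by simp
      qed
      moreover have "?r \<noteq> 0" using r(1) by linarith
      ultimately show ?thesis by blast
    qed
    also have "(6 * 12 ^ 9 * ?r ^ 2) ^ y \<le> (1 / 4) ^ y"
    proof (intro power_mono)
      have "6 * 12 ^ 9 * ?r ^ 2 \<le> 6 * 12 ^ 9 * (1 / 10 ^ 6) ^ 2"
        using r by (intro mult_left_mono power_mono) auto
      also have "\<dots> \<le> (1 / 4 :: real)" by (simp add: power2_eq_square)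
      finally show "6 * 12 ^ 9 * ?r ^ 2 \<le> 1 / 4" .
    qed simp
    finally show ?thesis .
  qed
  have "traps s A T = (\<Union>y\<in>{1..s}. {Y. Y \<subseteq> A \<and> card Y = y} \<times> {S. S \<subseteq> T \<and> card S = 6 * y})"
    using fin by (auto simp: traps_def Suc_le_eq card_gt_0_iff finite_subset[OF _ fin(1)])
  then have "trap_potential t 9 s A T {} = (\<Sum>y=1..s. \<Sum>(Y, S)\<in>{Y. Y \<subseteq> A \<and> card Y = y} \<times> {S. S \<subseteq> T \<and> card S = 6 * y}.
      trap_weight t 9 {} Y S)"
    unfolding trap_potential_def using fin by (simp, subst sum.UNION_disjoint) auto
  also have "\<dots> = (\<Sum>y=1..s. real ((t + 1) choose y) * real (t choose (6 * y)) * (12 * real y / real t) ^ (9 * y))"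
  proof (rule sum.cong[OF refl])
    fix y assume "y \<in> {1..s}"
    have "(\<Sum>(Y, S)\<in>{Y. Y \<subseteq> A \<and> card Y = y} \<times> {S. S \<subseteq> T \<and> card S = 6 * y}. trap_weight t 9 {} Y S) =
      (\<Sum>(Y, S)\<in>{Y. Y \<subseteq> A \<and> card Y = y} \<times> {S. S \<subseteq> T \<and> card S = 6 * y}. (12 * real y / real t) ^ (9 * y))"
      by (intro sum.cong) (auto simp: trap_weight_def mult.commute)
    also have "\<dots> = real (card {Y. Y \<subseteq> A \<and> card Y = y}) * real (card {S. S \<subseteq> T \<and> card S = 6 * y}) * (12 * real y / real t) ^ (9 * y)"
      by (simp add: card_cartesian_product case_prod_unfold)
    finally show "(\<Sum>(Y, S)\<in>{Y. Y \<subseteq> A \<and> card Y = y} \<times> {S. S \<subseteq> T \<and> card S = 6 * y}. trap_weight t 9 {} Y S) =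
      real ((t + 1) choose y) * real (t choose (6 * y)) * (12 * real y / real t) ^ (9 * y)"
      using fin c by (simp add: n_subsets)
  qed
  also have "\<dots> \<le> (\<Sum>y=1..s. (1 / 4) ^ y)" by (intro sum_mono bound)
  also have "\<dots> \<le> (\<Sum>y\<in>{1..s}. 1 / 4 * (1 / 4) ^ (y - 1))"
    by (intro sum_mono) (simp add: power_eq_if)
  also have "\<dots> = 1 / 4 * (\<Sum>y<s. (1 / 4) ^ y)"
    unfolding sum_distrib_left by (rule sum.reindex_bij_witness[of _ Suc "\<lambda>y. y - 1"]) auto
  also have "\<dots> < 1"
  proof -
    have "(\<Sum>y<s. (1 / 4 :: real) ^ y) = (1 - (1 / 4) ^ s) / (1 - 1 / 4)" by (subst sum_gp_strict) simp
    also have "\<dots> \<le> 4 / 3" by simp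
    finally show ?thesis by simp
  qed
  finally show ?thesis .
qed

section \<open>Rotations at an expanding set of targets\<close>

text \<open>
  Let \<open>Z\<close> be a largest set, among those of size at most \<open>s\<close>, that expands badly once \<open>D\<close> and \<open>nb Z\<close>
  are deleted. It is small because \<open>6 * card Z < card D + 3 * card Z + 2 * card Z\<close>, and a set \<open>Y\<close> outside \<open>Z\<close> that
  expands badly could be added to it. The set \<open>nb Z\<close> has to go too: in the application it
  consists of the targets that have a neighbour in \<open>Z\<close>, and targets are used only while both
  neighbours are in the core.
\<close>

lemma expanding_core:
  fixes N :: "'a \<Rightarrow> 'b set" and nb :: "'a \<Rightarrow> 'b set"
  assumes A: "finite A" and N: "\<And>a. a \<in> A \<Longrightarrow> finite (N a)" and D: "finite D"
    and nb: "\<And>a. finite (nb a)" "\<And>a. card (nb a) \<le> 2"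
    and exp: "\<And>Y. Y \<subseteq> A \<Longrightarrow> Y \<noteq> {} \<Longrightarrow> card Y \<le> s \<Longrightarrow> 6 * card Y < card (\<Union> (N ` Y))"
  obtains Z where "Z \<subseteq> A" "card Z \<le> card D"
    "\<And>Y. Y \<subseteq> A - Z \<Longrightarrow> Y \<noteq> {} \<Longrightarrow> card Y + card D \<le> s \<Longrightarrow>
       3 * card Y < card (\<Union> (N ` Y) - D - \<Union> (nb ` Z))"
proof -
  define bad where "bad Z \<longleftrightarrow> Z \<subseteq> A \<and> card Z \<le> s \<and>
      card (\<Union> (N ` Z) - D - \<Union> (nb ` Z)) \<le> 3 * card Z" for Z
  have finN: "finite (\<Union> (N ` Z))" if "Z \<subseteq> A" for Z
    using that A N by (auto intro: finite_subset)
  have cnb: "finite (\<Union> (nb ` Z))" "card (\<Union> (nb ` Z)) \<le> 2 * card Z" if "Z \<subseteq> A" for Z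
  proof -
    have fZ: "finite Z" using that A by (rule finite_subset)
    then show "finite (\<Union> (nb ` Z))" using nb by auto
    have "card (\<Union> (nb ` Z)) \<le> (\<Sum>a\<in>Z. card (nb a))" by (rule card_UN_le[OF fZ])
    also have "\<dots> \<le> (\<Sum>a\<in>Z. 2)" by (intro sum_mono nb)
    finally show "card (\<Union> (nb ` Z)) \<le> 2 * card Z" by simp
  qed
  have "bad {}" by (simp add: bad_def)
  moreover have "\<forall>Z. bad Z \<longrightarrow> card Z < Suc s" by (auto simp: bad_def)
  ultimately obtain Z where Z: "bad Z" and max: "\<And>Z'. bad Z' \<Longrightarrow> card Z' \<le> card Z"
    using ex_has_greatest_nat[of bad "{}" card "Suc s"] by (metis less_imp_le)
  have ZA: "Z \<subseteq> A" "card Z \<le> s" using Z by (auto simp: bad_def)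
  have cZ: "card Z \<le> card D"
  proof (cases "Z = {}")
    case False
    have "\<Union> (N ` Z) \<subseteq> (\<Union> (N ` Z) - D - \<Union> (nb ` Z)) \<union> (D \<union> \<Union> (nb ` Z))" by blast
    then have "card (\<Union> (N ` Z)) \<le> card ((\<Union> (N ` Z) - D - \<Union> (nb ` Z)) \<union> (D \<union> \<Union> (nb ` Z)))"
      using finN[OF ZA(1)] cnb[OF ZA(1)] D by (intro card_mono) auto
    also have "\<dots> \<le> card (\<Union> (N ` Z) - D - \<Union> (nb ` Z)) + (card D + card (\<Union> (nb ` Z)))"
      by (meson add_left_mono card_Un_le order_trans)
    also have "\<dots> \<le> 3 * card Z + (card D + 2 * card Z)"
      using Z cnb[OF ZA(1)] by (auto simp: bad_def)
    finally show ?thesis using exp[OF ZA(1) False ZA(2)] by linarith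
  qed simp
  show ?thesis
  proof (rule that[OF ZA(1) cZ])
    fix Y assume Y: "Y \<subseteq> A - Z" "Y \<noteq> {}" "card Y + card D \<le> s"
    have fin: "finite Y" "finite Z" using Y ZA A by (auto intro: finite_subset)
    have c: "card (Y \<union> Z) = card Y + card Z" using Y fin by (intro card_Un_disjoint) auto
    have "0 < card Y" using Y fin by (simp add: card_gt_0_iff)
    then have "\<not> bad (Y \<union> Z)" using max[of "Y \<union> Z"] c by auto
    then have "3 * (card Y + card Z) < card (\<Union> (N ` (Y \<union> Z)) - D - \<Union> (nb ` (Y \<union> Z)))"
      using Y ZA cZ c by (auto simp: bad_def not_le)
    also have "\<dots> \<le> card ((\<Union> (N ` Y) - D - \<Union> (nb ` Z)) \<union> (\<Union> (N ` Z) - D - \<Union> (nb ` Z)))"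
      using finN[of Y] finN[of Z] Y ZA by (intro card_mono) auto
    also have "\<dots> \<le> card (\<Union> (N ` Y) - D - \<Union> (nb ` Z)) + card (\<Union> (N ` Z) - D - \<Union> (nb ` Z))"
      by (rule card_Un_le)
    also have "\<dots> \<le> card (\<Union> (N ` Y) - D - \<Union> (nb ` Z)) + 3 * card Z"
      using Z by (simp add: bad_def)
    finally show "3 * card Y < card (\<Union> (N ` Y) - D - \<Union> (nb ` Z))" by simp
  qed
qed

text \<open>
  Rotations that break only pairs behind a vertex of \<open>T\<close>. They all keep the first vertex of the list.
\<close>

inductive rot_reach :: "'a set set \<Rightarrow> 'a set \<Rightarrow> 'a list \<Rightarrow> 'a list \<Rightarrow> bool" for M T p where
  start: "rot_reach M T p p"
| rotate: "rot_reach M T p (xs @ x # ys) \<Longrightarrow> ys \<noteq> [] \<Longrightarrow> x \<in> T \<Longrightarrow> {last ys, x} \<in> M \<Longrightarrow>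
     rot_reach M T p (xs @ x # rev ys)"

lemma card_pair_nbrs:
  assumes "distinct p" "p \<noteq> []"
  shows "finite {y. {x, y} \<in> pairs p}" "card {y. {x, y} \<in> pairs p} \<le> 2"
proof -
  have sub: "{y. {x, y} \<in> pairs p} \<subseteq> {y. {x, y} \<in> cyc p}" by (auto simp: cyc_def)
  then show "finite {y. {x, y} \<in> pairs p}" by (rule finite_subset) (rule card_cyc_nbrs[OF assms])
  show "card {y. {x, y} \<in> pairs p} \<le> 2"
    using card_mono[OF card_cyc_nbrs(1)[OF assms] sub] card_cyc_nbrs(2)[OF assms, of x] by linarith
qed

text \<open>
  A new last vertex was the successor of a vertex of \<open>T\<close>, so it is in \<open>A\<close>; and a vertex of \<open>T\<close> that
  loses a neighbour gets the old last vertex, which is in \<open>A\<close>, in exchange. The last clause says the same of the closed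
  order, for a larger set \<open>A'\<close>.
\<close>

lemma rot_reach_invariant:
  assumes p: "distinct p" "last p \<in> A" and AT: "A \<inter> T = {}" and A': "A \<subseteq> A'"
    and T: "\<And>x. x \<in> T \<Longrightarrow> {y. {x, y} \<in> pairs p} \<subseteq> A"
    and q: "rot_reach M T p q"
  shows "distinct q \<and> set q = set p \<and> hd q = hd p \<and> last q \<in> A \<and> pairs q \<subseteq> pairs p \<union> M \<and>
    (\<forall>x\<in>T. {y. {x, y} \<in> pairs q} \<subseteq> A) \<and>
    (\<forall>y. y \<notin> A' \<longrightarrow> {z. {y, z} \<in> cyc p} \<subseteq> A' \<longrightarrow> {z. {y, z} \<in> cyc q} \<subseteq> A')"
  using q
proof (induction rule: rot_reach.induct)
  case start
  then show ?case using p T by auto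
next
  case (rotate xs x ys)
  let ?q = "xs @ x # ys" and ?q' = "xs @ x # rev ys"
  have d: "distinct ?q" and IH: "set ?q = set p" "hd ?q = hd p" "last ?q \<in> A" "pairs ?q \<subseteq> pairs p \<union> M"
    "\<And>x. x \<in> T \<Longrightarrow> {y. {x, y} \<in> pairs ?q} \<subseteq> A"
    "\<And>y. y \<notin> A' \<Longrightarrow> {z. {y, z} \<in> cyc p} \<subseteq> A' \<Longrightarrow> {z. {y, z} \<in> cyc ?q} \<subseteq> A'"
    using rotate.IH by auto
  note rp = rotation_props[OF d rotate.hyps(2)]
  have hd: "hd ys \<in> A" using IH(5)[OF rotate.hyps(3)] pairs_split[OF rotate.hyps(2), of xs x] by auto
  have la: "last ys \<in> A" using IH(3) rp(5) by simp
  have sub: "pairs ?q' \<subseteq> insert {x, last ys} (pairs ?q)"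
    using pairs_rotation[OF rotate.hyps(2), of xs x] pairs_split[OF rotate.hyps(2), of xs x] by auto
  have csub: "cyc ?q' \<subseteq> insert {x, last ys} (insert {hd ys, hd ?q} (cyc ?q))"
    using sub unfolding cyc_def rp(3,4) by auto
  have "pairs ?q' \<subseteq> pairs p \<union> M" using sub IH(4) rotate.hyps(4) by (auto simp: insert_commute)
  moreover have "{z. {y, z} \<in> pairs ?q'} \<subseteq> A" if "y \<in> T" for y
    using sub IH(5)[OF that] that la AT by (fastforce simp: doubleton_eq_iff)
  moreover have "{z. {y, z} \<in> cyc ?q'} \<subseteq> A'" if "y \<notin> A'" "{z. {y, z} \<in> cyc p} \<subseteq> A'" for y
  proof
    fix z assume "z \<in> {z. {y, z} \<in> cyc ?q'}"
    then have "{y, z} = {x, last ys} \<or> {y, z} = {hd ys, hd ?q} \<or> {y, z} \<in> cyc ?q" using csub by blast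
    then show "z \<in> A'" using IH(6)[OF that] la hd A' that(1) by (auto simp: doubleton_eq_iff)
  qed
  ultimately show ?case using rp IH(1,2) hd by simp
qed

text \<open>
  Posa's argument. The neighbours of \<open>x \<in> T\<close> in the list change only if a neighbour that \<open>x\<close> had in \<open>p\<close>
  becomes the last vertex. Hence, if \<open>x\<close> is joined by \<open>M\<close> to a possible last vertex, rotating there shows
  that a neighbour of \<open>x\<close> in \<open>p\<close> is a possible last vertex too. So the set of possible last vertices has at
  most twice as many \<open>M\<close>-neighbours in \<open>T\<close> as elements, and by expansion it is large.
\<close>

lemma posa_rotations:
  assumes p: "distinct p" "p \<noteq> []" "last p \<in> A" and AT: "A \<inter> T = {}"
    and T: "\<And>x. x \<in> T \<Longrightarrow> x \<in> set p" "\<And>x. x \<in> T \<Longrightarrow> {y. {x, y} \<in> pairs p} \<subseteq> A"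
    and exp: "\<And>Y. Y \<subseteq> A \<Longrightarrow> Y \<noteq> {} \<Longrightarrow> finite Y \<Longrightarrow> card Y \<le> s \<Longrightarrow>
      2 * card Y < card {x \<in> T. \<exists>y\<in>Y. {y, x} \<in> M}"
  shows "s < card {last q | q. rot_reach M T p q}"
proof -
  define R where "R = {last q | q. rot_reach M T p q}"
  have inv: "distinct q \<and> set q = set p \<and> hd q = hd p \<and> last q \<in> A" if "rot_reach M T p q" for q
    using rot_reach_invariant[OF p(1,3) AT subset_refl _ that] T(2) by blast
  have RA: "R \<subseteq> A" using inv unfolding R_def by blast
  have "R \<subseteq> set p"
  proof
    fix r assume "r \<in> R"
    then obtain q where q: "rot_reach M T p q" "r = last q" unfolding R_def by blast
    then have "set q = set p" using inv by blast
    then show "r \<in> set p" using p(2) q(2) by (metis last_in_set set_empty)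
  qed
  then have fR: "finite R" by (auto intro: finite_subset)
  have keep: "{y. {z, y} \<in> pairs q} = {y. {z, y} \<in> pairs p} \<or> {y. {z, y} \<in> pairs p} \<inter> R \<noteq> {}"
    if "rot_reach M T p q" "z \<in> T" for q z
    using that
  proof (induction rule: rot_reach.induct)
    case (rotate xs x ys)
    let ?q = "xs @ x # ys" and ?q' = "xs @ x # rev ys"
    have q': "rot_reach M T p ?q'" using rotate.hyps by (rule rot_reach.rotate)
    have la: "last ys \<in> A" using inv[OF rotate.hyps(1)] rotate.hyps(2) by simp
    have hdA: "hd ys \<in> A" using inv[OF q'] rotate.hyps(2) by (auto simp: last_rev)
    have hdR: "hd ys \<in> R" using q' rotate.hyps(2) unfolding R_def
      by (intro CollectI exI[of _ ?q']) (auto simp: last_rev)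
    have ps: "pairs ?q' = insert {x, last ys} (pairs (xs @ [x]) \<union> pairs ys)"
      "pairs ?q = insert {x, hd ys} (pairs (xs @ [x]) \<union> pairs ys)"
      using pairs_rotation[OF rotate.hyps(2), of xs x] pairs_split[OF rotate.hyps(2), of xs x] by auto
    show ?case
    proof (cases "z = x")
      case True
      have "hd ys \<in> {y. {z, y} \<in> pairs ?q}" using ps True by simp
      then show ?thesis using rotate.IH[OF rotate.prems] hdR by blast
    next
      case False
      have "z \<noteq> hd ys" "z \<noteq> last ys" using rotate.prems AT hdA la by auto
      then have "{y. {z, y} \<in> pairs ?q'} = {y. {z, y} \<in> pairs ?q}"
        using False unfolding ps by (auto simp: doubleton_eq_iff)
      then show ?thesis using rotate.IH[OF rotate.prems] by simp
    qed
  qed simp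
  have sub: "{x \<in> T. \<exists>y\<in>R. {y, x} \<in> M} \<subseteq> (\<Union>r\<in>R. {x. {r, x} \<in> pairs p})"
  proof
    fix x assume "x \<in> {x \<in> T. \<exists>y\<in>R. {y, x} \<in> M}"
    then obtain q where x: "x \<in> T" "{last q, x} \<in> M" "rot_reach M T p q" by (auto simp: R_def)
    have i: "set q = set p" "last q \<in> A" using inv[OF x(3)] by auto
    have "x \<in> set q" using T(1) x i by auto
    then obtain xs ys where q: "q = xs @ x # ys" by (auto dest: split_list)
    have ne: "ys \<noteq> []" using i(2) x(1) AT q by auto
    have "rot_reach M T p (xs @ x # rev ys)" using x q ne by (auto intro: rot_reach.rotate)
    then have "hd ys \<in> R" using ne unfolding R_def
      by (intro CollectI exI[of _ "xs @ x # rev ys"]) (auto simp: last_rev)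
    moreover have "hd ys \<in> {y. {x, y} \<in> pairs q}" using q pairs_split[OF ne, of xs x] by simp
    ultimately have "{y. {x, y} \<in> pairs p} \<inter> R \<noteq> {}" using keep[OF x(3,1)] by blast
    then show "x \<in> (\<Union>r\<in>R. {x. {r, x} \<in> pairs p})" by (auto simp: insert_commute)
  qed
  have "card {x \<in> T. \<exists>y\<in>R. {y, x} \<in> M} \<le> card (\<Union>r\<in>R. {x. {r, x} \<in> pairs p})"
    using sub fR card_pair_nbrs[OF p(1,2)] by (intro card_mono) auto
  also have "\<dots> \<le> (\<Sum>r\<in>R. card {x. {r, x} \<in> pairs p})" by (rule card_UN_le[OF fR])
  also have "\<dots> \<le> (\<Sum>r\<in>R. 2)" by (intro sum_mono card_pair_nbrs[OF p(1,2)])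
  finally have "card {x \<in> T. \<exists>y\<in>R. {y, x} \<in> M} \<le> 2 * card R" by simp
  moreover have "R \<noteq> {}" unfolding R_def using rot_reach.start by blast
  ultimately have "\<not> card R \<le> s" using exp[OF RA _ fR] by auto
  then show ?thesis by (simp add: R_def)
qed

text \<open>
  The targets that rotations may no longer use, because breaking a pair there could produce an
  end outside \<open>A\<close>.
\<close>

definition frayed :: "'a set \<Rightarrow> 'a set \<Rightarrow> 'a list \<Rightarrow> 'a set" where
  "frayed A T p = {x \<in> T. \<not> {y. {x, y} \<in> cyc p} \<subseteq> A}"

lemma card_frayed_rotate_at:
  assumes "distinct p" "Suc i < length p" "finite T"
  shows "card (frayed A T (rotate_at i p)) \<le> card (frayed A T p) + 4"
proof -
  let ?S = "{p ! i, last p, p ! Suc i, hd p}"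
  have "frayed A T (rotate_at i p) \<subseteq> frayed A T p \<union> ?S"
    using cyc_rotate_at[OF assms(1,2)] by (fastforce simp: frayed_def doubleton_eq_iff)
  then have "card (frayed A T (rotate_at i p)) \<le> card (frayed A T p \<union> ?S)"
    by (rule card_mono[rotated]) (simp add: frayed_def assms)
  also have "\<dots> \<le> card (frayed A T p) + card ?S" by (rule card_Un_le)
  also have "card ?S \<le> 4" by (simp add: card_insert_if)
  finally show ?thesis by simp
qed

text \<open>
  The last clause guarantees that no target becomes frayed.
\<close>

definition rearranged :: "'a set set \<Rightarrow> 'a set \<Rightarrow> 'a list \<Rightarrow> 'a list \<Rightarrow> bool" where
  "rearranged M A p q \<longleftrightarrow> distinct q \<and> set q = set p \<and> hd q = hd p \<and> pairs q \<subseteq> pairs p \<union> M \<and>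
    (\<forall>y. y \<notin> A \<longrightarrow> {z. {y, z} \<in> cyc p} \<subseteq> A \<longrightarrow> {z. {y, z} \<in> cyc q} \<subseteq> A)"

text \<open>
  More than \<open>r\<close> vertices can be made the last one without moving the first one and without
  creating a gap inside the list.
\<close>

definition rich :: "nat \<Rightarrow> 'a set set \<Rightarrow> 'a set \<Rightarrow> 'a list \<Rightarrow> bool" where
  "rich r M A p \<longleftrightarrow> (\<exists>R. r < card R \<and> (\<forall>e\<in>R. \<exists>q. rearranged M A p q \<and> last q = e))"

text \<open>
  The indices \<open>I\<close> belong to the targets in an expanding core for the present order. After the rotation at
  such a target \<open>p ! i\<close> the last vertex is its former successor, which is in the core, and the
  core loses only \<open>p ! i\<close>. Here it matters that the core expands by a factor of 3, whereas
  \<open>posa_rotations\<close> needs a factor of 2. A core computed for the rotated order would not do: it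
  would depend on \<open>i\<close>, and so could omit the new last vertex.
\<close>

lemma jump_makes_rich:
  assumes p: "distinct p" "length p \<ge> 3" and AT: "A \<inter> T = {}" "finite A" "finite T"
    and Ac: "Ac \<subseteq> A" and out: "\<And>a x. a \<in> Ac \<Longrightarrow> (a, x) \<in> out \<Longrightarrow> x \<in> T \<and> {a, x} \<in> M"
    and T: "T \<subseteq> set p"
    and exp: "\<And>Y. Y \<subseteq> Ac \<Longrightarrow> Y \<noteq> {} \<Longrightarrow> card Y \<le> s \<Longrightarrow> 6 * card Y < card (\<Union> ((\<lambda>a. out `` {a}) ` Y))"
    and D: "card (frayed Ac T p) + 1 + r \<le> s"
  obtains I where "I \<subseteq> {..<length p - 1}" "card T \<le> card I + 3 * card (frayed Ac T p) + 3"
    "\<And>i M'. i \<in> I \<Longrightarrow> M \<subseteq> M' \<Longrightarrow> {last p, p ! i} \<in> M' \<Longrightarrow> p ! i \<in> T \<and> rich r M' A (rotate_at i p)"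
proof -
  have ne: "p \<noteq> []" using p by auto
  \<comment> \<open>The rotation gives \<open>last p\<close> the neighbour \<open>p ! i\<close>, which is not in \<open>A\<close>.\<close>
  define D' where "D' = frayed Ac T p \<union> ({last p} \<inter> T)"
  have fD: "finite D'" using AT by (auto simp: D'_def frayed_def)
  have cD: "card D' \<le> card (frayed Ac T p) + 1"
    unfolding D'_def by (rule order_trans[OF card_Un_le]) (auto simp: card_insert_if Int_insert_left)
  define nb where "nb a = {x. {a, x} \<in> cyc p}" for a
  have fAc: "finite Ac" using Ac AT by (auto intro: finite_subset)
  have fN: "finite (out `` {a})" if "a \<in> Ac" for a
    by (rule finite_subset[OF _ AT(3)]) (use out that in auto)
  obtain Z where Z: "Z \<subseteq> Ac" "card Z \<le> card D'"
    and core: "\<And>Y. Y \<subseteq> Ac - Z \<Longrightarrow> Y \<noteq> {} \<Longrightarrow> card Y + card D' \<le> s \<Longrightarrow>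
       3 * card Y < card (\<Union> ((\<lambda>a. out `` {a}) ` Y) - D' - \<Union> (nb ` Z))"
    using expanding_core[of Ac "\<lambda>a. out `` {a}" D' nb s] fAc fN fD card_cyc_nbrs[OF p(1) ne] exp
    unfolding nb_def by blast
  define A1 where "A1 = Ac - Z"
  define T1 where "T1 = T - D' - \<Union> (nb ` Z)"
  have T1: "{y. {x, y} \<in> cyc p} \<subseteq> A1" if "x \<in> T1" for x
    using that unfolding T1_def D'_def A1_def frayed_def nb_def by (auto simp: insert_commute)
  have lastT1: "last p \<notin> T1" unfolding T1_def D'_def by auto
  have T1T: "T1 \<subseteq> T" by (auto simp: T1_def)
  have A1A: "A1 \<subseteq> A" using Ac by (auto simp: A1_def)
  have disj: "A1 \<inter> T1 = {}" using AT(1) A1A T1T by auto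
  define I where "I = {i. i < length p - 1 \<and> p ! i \<in> T1}"
  have T1I: "T1 = (\<lambda>i. p ! i) ` I"
  proof (intro equalityI subsetI)
    fix x assume x: "x \<in> T1"
    then obtain i where i: "i < length p" "x = p ! i" using T T1T by (metis in_set_conv_nth subsetD)
    then have "i \<noteq> length p - 1" using lastT1 x ne by (auto simp: last_conv_nth)
    then show "x \<in> (\<lambda>i. p ! i) ` I" using i x by (auto simp: I_def)
  qed (auto simp: I_def)
  have cI: "card T1 \<le> card I" unfolding T1I by (rule card_image_le) (simp add: I_def)
  show ?thesis
  proof (rule that[of I])
    show "I \<subseteq> {..<length p - 1}" by (auto simp: I_def)
    have fZ: "finite Z" using Z fAc by (auto intro: finite_subset)
    have fnb: "finite (\<Union> (nb ` Z))" using fZ card_cyc_nbrs(1)[OF p(1) ne] by (auto simp: nb_def)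
    have "card (\<Union> (nb ` Z)) \<le> (\<Sum>a\<in>Z. card (nb a))" by (rule card_UN_le[OF fZ])
    also have "\<dots> \<le> (\<Sum>a\<in>Z. 2)" unfolding nb_def by (intro sum_mono card_cyc_nbrs[OF p(1) ne])
    finally have cnb: "card (\<Union> (nb ` Z)) \<le> 2 * card Z" by simp
    have "T \<subseteq> T1 \<union> (D' \<union> \<Union> (nb ` Z))" by (auto simp: T1_def)
    then have "card T \<le> card (T1 \<union> (D' \<union> \<Union> (nb ` Z)))"
      using fD fnb T1T AT(3) by (intro card_mono) (auto intro: finite_subset)
    also have "\<dots> \<le> card T1 + (card D' + card (\<Union> (nb ` Z)))"
      by (meson add_left_mono card_Un_le order_trans)
    finally show "card T \<le> card I + 3 * card (frayed Ac T p) + 3" using cnb cI cD Z(2) by linarith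
  next
    fix i M' assume iI: "i \<in> I" and M': "M \<subseteq> M'" "{last p, p ! i} \<in> M'"
    have i: "Suc i < length p" "p ! i \<in> T1" using iI by (auto simp: I_def)
    \<comment> \<open>The vertex \<open>p ! i\<close> is now next to \<open>last p\<close>, which need not be in \<open>A\<close>.\<close>
    let ?q = "rotate_at i p" and ?T2 = "T1 - {p ! i}"
    note q = rotate_at_props[OF p(1) i(1)]
    have "{p ! i, p ! Suc i} \<in> cyc p" using i(1) by (auto simp: cyc_def pairs_conv_nth)
    then have lastA: "last ?q \<in> A1" using T1[OF i(2)] q(4) by auto
    have nbrs: "{y. {x, y} \<in> pairs ?q} \<subseteq> A1" if x: "x \<in> ?T2" for x
    proof
      fix y assume "y \<in> {y. {x, y} \<in> pairs ?q}"
      then have "{x, y} = {p ! i, last p} \<or> {x, y} \<in> pairs p" using pairs_rotate_at[OF p(1) i(1)] by blast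
      moreover have "x \<noteq> p ! i" "x \<noteq> last p" using x lastT1 by auto
      ultimately show "y \<in> A1" using T1[of x] x by (auto simp: doubleton_eq_iff cyc_def)
    qed
    have "s - card D' < card {last q' | q'. rot_reach M' ?T2 ?q q'}"
    proof (rule posa_rotations[of ?q A1 ?T2])
      fix Y assume Y: "Y \<subseteq> A1" "Y \<noteq> {}" "finite Y" "card Y \<le> s - card D'"
      have "card D' \<le> s" using cD D by linarith
      then have "3 * card Y < card (\<Union> ((\<lambda>a. out `` {a}) ` Y) - D' - \<Union> (nb ` Z))" (is "_ < card ?L")
        using core[of Y] Y unfolding A1_def by simp
      moreover have "card Y > 0" using Y by (simp add: card_gt_0_iff)
      moreover have "card ?L \<le> Suc (card (?L - {p ! i}))"
        using diff_card_le_card_Diff[of "{p ! i}" ?L] by simp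
      moreover have "card (?L - {p ! i}) \<le> card {x \<in> ?T2. \<exists>y\<in>Y. {y, x} \<in> M'}"
      proof (intro card_mono subsetI)
        show "finite {x \<in> ?T2. \<exists>y\<in>Y. {y, x} \<in> M'}"
          by (rule finite_subset[OF _ AT(3)]) (use T1T in auto)
        fix x assume x: "x \<in> ?L - {p ! i}"
        then obtain a where a: "a \<in> Y" "(a, x) \<in> out" by auto
        then have "a \<in> Ac" using Y(1) by (auto simp: A1_def)
        then have "x \<in> T" "{a, x} \<in> M'" using out a(2) M'(1) by blast+
        then show "x \<in> {x \<in> ?T2. \<exists>y\<in>Y. {y, x} \<in> M'}" using x a(1) unfolding T1_def by blast
      qed
      ultimately show "2 * card Y < card {x \<in> ?T2. \<exists>y\<in>Y. {y, x} \<in> M'}" by linarith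
    qed (use q lastA disj nbrs T T1T ne in \<open>auto simp: rotate_at_def\<close>)
    moreover have "rearranged M' A ?q q'" if "rot_reach M' ?T2 ?q q'" for q'
      using rot_reach_invariant[OF q(1) lastA _ A1A nbrs that] disj unfolding rearranged_def by blast
    moreover have "r \<le> s - card D'" using cD D by linarith
    ultimately have "rich r M' A ?q" unfolding rich_def
      by (intro exI[of _ "{last q' | q'. rot_reach M' ?T2 ?q q'}"]) auto
    then show "p ! i \<in> T \<and> rich r M' A ?q" using i(2) T1T by blast
  qed
qed

section \<open>Maker's strategy\<close>

lemma finite_complete_edges: "finite (complete_edges n)"
  by (rule finite_subset[of _ "Pow {..<n}"]) (auto simp: complete_edges_def)

lemma complete_edges_card: "e \<in> complete_edges n \<Longrightarrow> card e = 2"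
  by (simp add: complete_edges_def)

lemma doubleton_in_complete_edges: "{x, y} \<in> complete_edges n \<longleftrightarrow> x < n \<and> y < n \<and> x \<noteq> y"
  by (auto simp: complete_edges_def card_insert_if)

lemma gapdeg_pos_iff: "0 < gapdeg M p v \<longleftrightarrow> (\<exists>e\<in>gaps M p. v \<in> e)"
  unfolding gapdeg_def by (subst card_gt_0_iff) (auto simp: finite_gaps)

lemma frayed_cong: "cyc q = cyc p \<Longrightarrow> frayed A T q = frayed A T p"
  by (simp add: frayed_def)

text \<open>
  Breaker has bias \<open>b\<close>, and \<open>K\<close> rounds are played. A vertex is dangerous if its Breaker-degree is at
  least \<open>\<tau>\<close>; there are at most \<open>2 * N\<close> of these. The greedy stage ends with \<open>g0\<close> gaps. Then \<open>t\<close> targets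
  are used, and sets of up to \<open>s\<close> vertices expand. In the bound for \<open>s\<close>, at most
  \<open>8 * g0 + 32 * N\<close> targets get frayed by rotations, \<open>4 * N\<close> more by dangerous vertices of \<open>A\<close> whose
  edges were never completed, one more target is lost when the list is opened, and more than \<open>\<tau>\<close>
  ends are wanted.
\<close>

locale hamilton_strategy =
  fixes n b \<tau> N g0 s t K :: nat
  assumes n_ge: "3 \<le> n" and tau_pos: "0 < \<tau>" and N_pos: "1 \<le> N"
    and breaker_total: "K * b \<le> N * \<tau>"
    and board_large: "K * (b + 1) \<le> card (complete_edges n)"
    and box_limit: "real \<tau> + real b * ln (real N) + real N + 2 * real b + 2 * real N + 1 < real n"
    and tau_le_g0: "\<tau> \<le> g0"
    and s_ge: "36 * N + 8 * g0 + 1 + \<tau> \<le> s"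
    and t_ge: "10 ^ 6 * s \<le> t" and t_fits: "2 * t + 1 \<le> n"
    and time_limit: "n + 8 * N + g0 + 9 * (t + 1) \<le> K"
begin

definition position :: "nat \<Rightarrow> nat set set \<Rightarrow> nat set set \<Rightarrow> nat list \<Rightarrow> bool" where
  "position k M B p \<longleftrightarrow> distinct p \<and> set p = {..<n} \<and> M \<subseteq> complete_edges n \<and> B \<subseteq> complete_edges n \<and>
    card M \<le> k \<and> card B \<le> k * b \<and> box_inv b \<tau> N {..<n} B (gapdeg M p)"

text \<open>
  At most 2 for each dangerous vertex, and raised by every move made at a dangerous vertex: this counts
  the moves that danger has forced.
\<close>

definition progress :: "nat set set \<Rightarrow> nat set set \<Rightarrow> nat list \<Rightarrow> nat" where
  "progress M B p = (\<Sum>v<n. treated \<tau> (vdeg B) (gapdeg M p) v)"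

definition calm :: "nat set set \<Rightarrow> nat set set \<Rightarrow> nat list \<Rightarrow> bool" where
  "calm M B p \<longleftrightarrow> (\<forall>v<n. \<tau> \<le> vdeg B v \<longrightarrow> gapdeg M p v = 0)"

text \<open>
  If Maker already owns the edge \<open>e\<close> that she wants, then \<open>e'\<close> is any free edge. Her move is wasted, but the list changes
  as intended, and the counters count changes of the list.
\<close>

definition reply :: "nat set set \<Rightarrow> nat set set \<Rightarrow> nat set \<Rightarrow> nat set \<Rightarrow> bool" where
  "reply M B e e' \<longleftrightarrow> e' \<in> complete_edges n - (M \<union> B) \<and> e \<in> insert e' M"

lemma length_position: "position k M B p \<Longrightarrow> length p = n"
  unfolding position_def by (metis card_lessThan distinct_card)

lemma position_reclose:
  assumes "position k M B p" "{v, u} \<in> cyc p"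
  shows "\<exists>q. cyc q = cyc p \<and> last q = v \<and> hd q = u \<and> position k M B q"
proof -
  have "p \<noteq> []" using length_position[OF assms(1)] n_ge by auto
  then obtain q where q: "cyc q = cyc p" "distinct q" "set q = set p" "last q = v" "hd q = u"
    using cyc_reclose[OF assms(2)] assms(1) unfolding position_def by blast
  moreover have "gapdeg M q = gapdeg M p" using gapdeg_cong[OF q(1)] by blast
  ultimately show ?thesis using assms(1) unfolding position_def by metis
qed

lemma card_dangerous:
  assumes "B \<subseteq> complete_edges n" "card B \<le> K * b"
  shows "card {v \<in> {..<n}. \<tau> \<le> vdeg B v} \<le> 2 * N"
  by (rule card_high_vdeg[OF finite_subset[OF assms(1) finite_complete_edges] _ _ _ tau_pos])
    (use assms breaker_total complete_edges_card in auto)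

lemma card_dangerous_successors:
  assumes B: "B \<subseteq> complete_edges n" "card B \<le> K * b" and p: "distinct p" "set p = {..<n}"
  shows "card {i. i < n - 1 \<and> \<tau> \<le> vdeg B (p ! Suc i)} \<le> 2 * N"
proof -
  have len: "length p = n" using p by (metis card_lessThan distinct_card)
  have "card {i. i < n - 1 \<and> \<tau> \<le> vdeg B (p ! Suc i)} \<le> card {v \<in> {..<n}. \<tau> \<le> vdeg B v}"
  proof (rule card_inj_on_le[where f = "\<lambda>i. p ! Suc i"])
    show "inj_on (\<lambda>i. p ! Suc i) {i. i < n - 1 \<and> \<tau> \<le> vdeg B (p ! Suc i)}"
    proof (rule inj_onI)
      fix i j assume "i \<in> {i. i < n - 1 \<and> \<tau> \<le> vdeg B (p ! Suc i)}"
        "j \<in> {i. i < n - 1 \<and> \<tau> \<le> vdeg B (p ! Suc i)}" "p ! Suc i = p ! Suc j"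
      then show "i = j" using nth_eq_iff_index_eq[OF p(1), of "Suc i" "Suc j"] len by auto
    qed
    have "p ! Suc i < n" if "i < n - 1" for i
      using nth_mem[of "Suc i" p] that len p(2) by auto
    then show "(\<lambda>i. p ! Suc i) ` {i. i < n - 1 \<and> \<tau> \<le> vdeg B (p ! Suc i)} \<subseteq> {v \<in> {..<n}. \<tau> \<le> vdeg B v}"
      by auto
  qed simp
  then show ?thesis using card_dangerous[OF B] by linarith
qed

lemma progress_le:
  assumes "position k M B p" "k \<le> K"
  shows "progress M B p \<le> 4 * N"
proof -
  have "card B \<le> K * b" using assms by (meson mult_le_mono1 order_trans position_def)
  then have c: "card {v \<in> {..<n}. \<tau> \<le> vdeg B v} \<le> 2 * N"
    using card_dangerous assms by (auto simp: position_def)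
  have "progress M B p = (\<Sum>v\<in>{v \<in> {..<n}. \<tau> \<le> vdeg B v}. 2 - gapdeg M p v)"
    unfolding progress_def treated_def by (simp add: sum.inter_filter[symmetric])
  also have "\<dots> \<le> (\<Sum>v\<in>{v \<in> {..<n}. \<tau> \<le> vdeg B v}. 2)" by (intro sum_mono) auto
  finally show ?thesis using c by simp
qed

lemma maker_can_reply:
  assumes pos: "position k M B p" "k < K" and X: "X \<subseteq> complete_edges n - (M \<union> B)" "card X \<le> b"
    and e: "e \<in> complete_edges n" "e \<notin> B \<union> X"
  shows "\<exists>e'. reply M (B \<union> X) e e'"
proof (cases "e \<in> M")
  case True
  have "card (M \<union> (B \<union> X)) \<le> card M + (card B + card X)"
    by (meson add_left_mono card_Un_le order_trans)
  also have "\<dots> \<le> k + (k * b + b)" using pos X unfolding position_def by linarith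
  also have "\<dots> < K * (b + 1)"
  proof -
    have "Suc k * b \<le> K * b" using pos(2) by (intro mult_le_mono1) simp
    then show ?thesis using pos(2) by (simp add: algebra_simps)
  qed
  also have "\<dots> \<le> card (complete_edges n)" by (rule board_large)
  finally have "M \<union> (B \<union> X) \<noteq> complete_edges n" by auto
  then show ?thesis using True pos X unfolding position_def reply_def by blast
qed (use e in \<open>auto simp: reply_def\<close>)

lemma position_advance:
  assumes pos: "position k M B p" and X: "X \<subseteq> complete_edges n - (M \<union> B)" "card X \<le> b" and kK: "k < K"
    and e: "reply M (B \<union> X) e e'" and q: "distinct q" "set q = {..<n}"
    and mono: "\<And>v. v < n \<Longrightarrow> \<tau> \<le> vdeg (B \<union> X) v \<Longrightarrow> gapdeg (insert e' M) q v \<le> gapdeg M p v"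
    and treat: "calm M (B \<union> X) p \<or>
      (\<exists>m<n. \<tau> \<le> vdeg (B \<union> X) m \<and> gapdeg (insert e' M) q m < gapdeg M p m \<and>
        (\<forall>v<n. \<tau> \<le> vdeg (B \<union> X) v \<longrightarrow> 0 < gapdeg M p v \<longrightarrow>
          real (vdeg (B \<union> X) v) - real b * real (treated \<tau> (vdeg (B \<union> X)) (gapdeg M p) v) \<le>
          real (vdeg (B \<union> X) m) - real b * real (treated \<tau> (vdeg (B \<union> X)) (gapdeg M p) m)))"
  shows "position (Suc k) (insert e' M) (B \<union> X) q"
    and "progress M B p \<le> progress (insert e' M) (B \<union> X) q"
    and "\<not> calm M (B \<union> X) p \<Longrightarrow> progress M B p < progress (insert e' M) (B \<union> X) q"
proof -
  let ?M = "insert e' M" and ?B = "B \<union> X"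
  have ne: "p \<noteq> []" using length_position[OF pos] n_ge by auto
  have sub: "?B \<subseteq> complete_edges n" "M \<subseteq> complete_edges n" using pos X by (auto simp: position_def)
  have fin: "finite B" "finite X" "finite M" "finite ?B"
    using sub finite_subset[OF _ finite_complete_edges] by auto
  have "card ?B \<le> card B + card X" by (rule card_Un_le)
  then have cB: "card ?B \<le> Suc k * b" using pos X by (auto simp: position_def)
  also have "\<dots> \<le> K * b" using kK by (intro mult_le_mono1) simp
  also have "\<dots> \<le> N * \<tau>" by (rule breaker_total)
  finally have size: "card ?B \<le> N * \<tau>" .
  have g2: "gapdeg M p v \<le> 2" for v using gapdeg_le_2[OF _ ne] pos by (auto simp: position_def)
  have "box_inv b \<tau> N {..<n} ?B (gapdeg ?M q)"
    by (rule box_inv_step[where B = B and X = X and g = "gapdeg M p"])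
      (use pos fin X sub complete_edges_card size mono g2 treat in \<open>auto simp: position_def calm_def\<close>)
  moreover have "card ?M \<le> Suc k" using pos by (auto simp: position_def card_insert_if fin)
  ultimately show "position (Suc k) ?M ?B q"
    using e q sub cB by (auto simp: position_def reply_def)
  have le: "treated \<tau> (vdeg B) (gapdeg M p) v \<le> treated \<tau> (vdeg ?B) (gapdeg ?M q) v" if "v \<in> {..<n}" for v
    using vdeg_mono[OF fin(4) Un_upper1] mono[of v] that by (intro treated_mono) auto
  then show "progress M B p \<le> progress ?M ?B q" unfolding progress_def by (rule sum_mono)
  assume "\<not> calm M ?B p"
  then obtain m where m: "m < n" "\<tau> \<le> vdeg ?B m" "gapdeg ?M q m < gapdeg M p m"
    using treat by blast
  have "treated \<tau> (vdeg B) (gapdeg M p) m < treated \<tau> (vdeg ?B) (gapdeg ?M q) m"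
    using m g2[of m] by (auto simp: treated_def)
  then show "progress M B p < progress ?M ?B q" unfolding progress_def
    using le m(1) by (intro sum_strict_mono_ex1) auto
qed

lemma gaps_expose:
  assumes "gaps M p \<noteq> {}"
  shows "\<exists>m. 0 < gapdeg M p m"
proof -
  obtain e where e: "e \<in> gaps M p" using assms by blast
  then have "e \<noteq> {}" by (auto simp: gaps_def cyc_def pairs_conv_nth)
  then show ?thesis using e by (auto simp: gapdeg_pos_iff)
qed

lemma exposed_has_gap:
  assumes pos: "position k M B p" and m: "0 < gapdeg M p m"
  obtains q where "cyc q = cyc p" "last q = m" "{m, hd q} \<in> gaps M q" "position k M B q"
proof -
  have ne: "p \<noteq> []" using length_position[OF pos] n_ge by auto
  obtain e where e: "e \<in> gaps M p" "m \<in> e" using m gapdeg_pos_iff by metis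
  then obtain u where u: "e = {m, u}" using cyc_pair_other[OF ne] by (auto simp: gaps_def)
  then have "{m, u} \<in> cyc p" using e by (auto simp: gaps_def)
  then obtain q where q: "cyc q = cyc p" "last q = m" "hd q = u" "position k M B q"
    using position_reclose[OF pos] by blast
  then show ?thesis using that[of q] e u gaps_cong[OF q(1)] by simp
qed

text \<open>
  The box game leaves Maker more than \<open>2 * N\<close> free edges at the worst vertex \<open>m\<close>, so for one of
  them the vertex that becomes exposed is not dangerous.
\<close>

lemma urgent_move:
  assumes pos: "position k M B p" and X: "X \<subseteq> complete_edges n - (M \<union> B)" "card X \<le> b" and kK: "k < K"
    and urgent: "\<not> calm M (B \<union> X) p"
  obtains e q where "e \<in> complete_edges n - (M \<union> B \<union> X)" "position (Suc k) (insert e M) (B \<union> X) q"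
    "progress M B p < progress (insert e M) (B \<union> X) q"
    "card (gaps (insert e M) q) \<le> card (gaps M p)"
    "\<And>A T. finite T \<Longrightarrow> card (frayed A T q) \<le> card (frayed A T p) + 4"
proof -
  let ?B = "B \<union> X"
  \<comment> \<open>The danger that the box game asks Maker to maximise: the degree minus the credit already earned.\<close>
  define dng where "dng v = real (vdeg ?B v) - real b * real (treated \<tau> (vdeg ?B) (gapdeg M p) v)" for v
  define W where "W = {v. v < n \<and> \<tau> \<le> vdeg ?B v \<and> 0 < gapdeg M p v}"
  have "finite W" "W \<noteq> {}" using urgent by (auto simp: W_def calm_def)
  then have "Max (dng ` W) \<in> dng ` W" by (intro Max_in) auto
  then obtain m where m: "m \<in> W" "dng m = Max (dng ` W)" by auto
  have max: "dng v \<le> dng m" if "v \<in> W" for v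
    using that \<open>finite W\<close> unfolding m(2) by (intro Max_ge) auto
  have mW: "m < n" "\<tau> \<le> vdeg ?B m" "0 < gapdeg M p m" using m(1) by (auto simp: W_def)
  obtain p' where p': "cyc p' = cyc p" "last p' = m" "{m, hd p'} \<in> gaps M p'" "position k M B p'"
    using exposed_has_gap[OF pos mW(3)] by blast
  note len = length_position[OF p'(4)]
  have d: "distinct p'" "set p' = {..<n}" using p'(4) by (auto simp: position_def)
  have sub: "?B \<subseteq> complete_edges n" using pos X by (auto simp: position_def)
  then have finB: "finite ?B" by (rule finite_subset) (rule finite_complete_edges)
  have "card ?B \<le> Suc k * b" using card_Un_le[of B X] pos X by (auto simp: position_def)
  also have "\<dots> \<le> K * b" using kK by (intro mult_le_mono1) simp
  finally have cB: "card ?B \<le> K * b" .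
  have deg: "real (vdeg ?B m) \<le> real \<tau> + real b * ln (real N) + real N + 2 * real b"
    using box_inv_degree[of b \<tau> N "{..<n}" B "gapdeg M p" X m] pos X(2) finB mW N_pos
    by (auto simp: position_def)
  define I where "I = {i. i < n - 1 \<and> \<not> \<tau> \<le> vdeg ?B (p' ! Suc i)}"
  have "card {i. i < n - 1 \<and> \<tau> \<le> vdeg ?B (p' ! Suc i)} \<le> 2 * N"
    by (rule card_dangerous_successors[OF sub _ d]) (rule cB)
  moreover have "{..<n - 1} = I \<union> {i. i < n - 1 \<and> \<tau> \<le> vdeg ?B (p' ! Suc i)}" by (auto simp: I_def)
  then have "n - 1 \<le> card I + card {i. i < n - 1 \<and> \<tau> \<le> vdeg ?B (p' ! Suc i)}"
    by (metis card_Un_le card_lessThan)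
  ultimately have "n - 1 \<le> card I + 2 * N" by linarith
  moreover have "vdeg ?B m + 2 * N + 1 < n" using deg box_limit by linarith
  ultimately have "vdeg ?B m < card I" by linarith
  also have "card I = card ((\<lambda>i. p' ! i) ` I)"
  proof (rule card_image[symmetric])
    show "inj_on (\<lambda>i. p' ! i) I" by (rule inj_on_nth[OF d(1)]) (use len in \<open>auto simp: I_def\<close>)
  qed
  finally obtain i where i: "i \<in> I" "{m, p' ! i} \<notin> ?B"
    using exists_free_partner[OF finB, of m] by blast
  have i': "Suc i < length p'" "\<not> \<tau> \<le> vdeg ?B (p' ! Suc i)" using i len by (auto simp: I_def)
  have ne: "p' ! i \<noteq> m" using nth_ne_last[OF d(1) i'(1)] p'(2) by simp
  have "{m, p' ! i} \<in> complete_edges n"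
    using ne mW(1) d(2) nth_mem[of i p'] i' by (auto simp: doubleton_in_complete_edges)
  then obtain e where e: "reply M ?B {m, p' ! i} e" using maker_can_reply[OF pos kK X] i(2) by blast
  let ?M = "insert e M" and ?q = "rotate_at i p'"
  have M: "M \<subseteq> ?M" "{last p', p' ! i} \<in> ?M" using e p'(2) by (auto simp: reply_def)
  have gap: "{last p', hd p'} \<in> gaps M p'" using p' by simp
  have len3: "length p' \<ge> 3" using len n_ge by simp
  note gr = gaps_rotate_at[OF d(1) i'(1) len3 M gap]
  note gd = gapdeg_cong[OF p'(1), of M]
  have "m \<noteq> p' ! Suc i" using mW i' by auto
  then have less: "gapdeg ?M ?q m < gapdeg M p m" using gr(2) p'(2) gd by simp
  have adv: "\<And>v. v < n \<Longrightarrow> \<tau> \<le> vdeg ?B v \<Longrightarrow> gapdeg ?M ?q v \<le> gapdeg M p v"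
    using gr(1) i'(2) gd by metis
  have treat: "\<exists>m<n. \<tau> \<le> vdeg ?B m \<and> gapdeg ?M ?q m < gapdeg M p m \<and>
        (\<forall>v<n. \<tau> \<le> vdeg ?B v \<longrightarrow> 0 < gapdeg M p v \<longrightarrow>
          real (vdeg ?B v) - real b * real (treated \<tau> (vdeg ?B) (gapdeg M p) v) \<le>
          real (vdeg ?B m) - real b * real (treated \<tau> (vdeg ?B) (gapdeg M p) m))"
    using mW less max unfolding dng_def W_def by blast
  have q: "distinct ?q" "set ?q = {..<n}" using rotate_at_props[OF d(1) i'(1)] d by auto
  note pa = position_advance[OF pos X kK e q adv disjI2[OF treat]]
  show ?thesis
  proof (rule that[of e ?q])
    show "e \<in> complete_edges n - (M \<union> B \<union> X)" using e by (auto simp: reply_def)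
    show "position (Suc k) ?M ?B ?q" by (rule pa(1))
    show "progress M B p < progress ?M ?B ?q" using pa(3) urgent by blast
    show "card (gaps ?M ?q) \<le> card (gaps M p)" using gr(3) gaps_cong[OF p'(1)] by metis
    show "card (frayed A T ?q) \<le> card (frayed A T p) + 4" if "finite T" for A T
      using card_frayed_rotate_at[OF d(1) i'(1) that, of A] frayed_cong[OF p'(1), of A T] by simp
  qed
qed

lemma calm_exposed: "calm M B p \<Longrightarrow> v < n \<Longrightarrow> 0 < gapdeg M p v \<Longrightarrow> vdeg B v < \<tau>"
  by (rule ccontr) (auto simp: calm_def)

lemma closing_gap_exposed:
  assumes "{last p, hd p} \<in> gaps M p"
  shows "0 < gapdeg M p (last p)" "0 < gapdeg M p (hd p)"
  using assms by (auto simp: gapdeg_pos_iff)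

text \<open>
  With more than \<open>\<tau>\<close> gaps inside the opened list, Breaker cannot own all edges from its last vertex to
  their first vertices.
\<close>

lemma greedy_move:
  assumes pos: "position k M B p" and X: "X \<subseteq> complete_edges n - (M \<union> B)" "card X \<le> b" and kK: "k < K"
    and calm: "calm M (B \<union> X) p" and many: "g0 < card (gaps M p)"
  obtains e q where "e \<in> complete_edges n - (M \<union> B \<union> X)" "position (Suc k) (insert e M) (B \<union> X) q"
    "progress M B p \<le> progress (insert e M) (B \<union> X) q"
    "card (gaps (insert e M) q) < card (gaps M p)"
proof -
  let ?B = "B \<union> X"
  have "gaps M p \<noteq> {}" using many by auto
  then obtain m where m: "0 < gapdeg M p m" using gaps_expose by blast
  obtain p' where p': "cyc p' = cyc p" "last p' = m" "{m, hd p'} \<in> gaps M p'" "position k M B p'"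
    using exposed_has_gap[OF pos m] by blast
  note len = length_position[OF p'(4)]
  have d: "distinct p'" "set p' = {..<n}" using p'(4) by (auto simp: position_def)
  have finB: "finite ?B"
    by (rule finite_subset[OF _ finite_complete_edges]) (use pos X in \<open>auto simp: position_def\<close>)
  have p'ne: "p' \<noteq> []" using len n_ge by auto
  have mn: "m < n" using p'(2) d(2) p'ne last_in_set by blast
  have deg: "vdeg ?B m < \<tau>" using calm_exposed[OF calm mn m] .
  define I where "I = {i. i < n - 1 \<and> {p' ! i, p' ! Suc i} \<in> gaps M p'}"
  have "gaps M p' \<subseteq> insert {m, hd p'} ((\<lambda>i. {p' ! i, p' ! Suc i}) ` I)"
    using p'(2) len by (auto simp: gaps_def cyc_def pairs_conv_nth I_def)
  then have "card (gaps M p') \<le> card (insert {m, hd p'} ((\<lambda>i. {p' ! i, p' ! Suc i}) ` I))"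
    by (intro card_mono) (auto simp: I_def)
  also have "\<dots> \<le> Suc (card ((\<lambda>i. {p' ! i, p' ! Suc i}) ` I))" by (rule card_insert_le_m1) auto
  also have "\<dots> \<le> Suc (card I)" by (simp add: card_image_le I_def)
  finally have "vdeg ?B m < card I" using many gaps_cong[OF p'(1), of M] deg tau_le_g0 by simp
  also have "card I = card ((\<lambda>i. p' ! i) ` I)"
  proof (rule card_image[symmetric])
    show "inj_on (\<lambda>i. p' ! i) I" by (rule inj_on_nth[OF d(1)]) (use len in \<open>auto simp: I_def\<close>)
  qed
  finally obtain i where i: "i \<in> I" "{m, p' ! i} \<notin> ?B"
    using exists_free_partner[OF finB, of m] by blast
  have i': "Suc i < length p'" "{p' ! i, p' ! Suc i} \<in> gaps M p'" using i len by (auto simp: I_def)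
  have "p' ! i \<noteq> m" using nth_ne_last[OF d(1) i'(1)] p'(2) by simp
  then have "{m, p' ! i} \<in> complete_edges n"
    using mn d(2) nth_mem[of i p'] i' by (auto simp: doubleton_in_complete_edges)
  then obtain e where e: "reply M ?B {m, p' ! i} e" using maker_can_reply[OF pos kK X] i(2) by blast
  let ?M = "insert e M" and ?q = "rotate_at i p'"
  have M: "M \<subseteq> ?M" "{last p', p' ! i} \<in> ?M" using e p'(2) by (auto simp: reply_def)
  have gap: "{last p', hd p'} \<in> gaps M p'" using p' by simp
  have len3: "length p' \<ge> 3" using len n_ge by simp
  note gr = gaps_rotate_at[OF d(1) i'(1) len3 M gap]
  have adv: "\<And>v. v < n \<Longrightarrow> \<tau> \<le> vdeg ?B v \<Longrightarrow> gapdeg ?M ?q v \<le> gapdeg M p v"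
    using gr(6)[OF i'(2)] gapdeg_cong[OF p'(1), of M] by simp
  have q: "distinct ?q" "set ?q = {..<n}" using rotate_at_props[OF d(1) i'(1)] d by auto
  note pa = position_advance[OF pos X kK e q adv disjI1[OF calm]]
  show ?thesis
  proof (rule that[of e ?q])
    show "e \<in> complete_edges n - (M \<union> B \<union> X)" using e by (auto simp: reply_def)
    show "position (Suc k) ?M ?B ?q" by (rule pa(1))
    show "progress M B p \<le> progress ?M ?B ?q" by (rule pa(2))
    show "card (gaps ?M ?q) < card (gaps M p)" using gr(5)[OF i'(2)] gaps_cong[OF p'(1), of M] by simp
  qed
qed

text \<open>
  The first vertex has Breaker-degree below \<open>\<tau>\<close>, so it has a free or own edge to one of the more
  than \<open>\<tau>\<close> possible last vertices. Closing the rearranged list there removes the closing gap.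
\<close>

lemma merge_move:
  assumes pos: "position k M B p" and X: "X \<subseteq> complete_edges n - (M \<union> B)" "card X \<le> b" and kK: "k < K"
    and calm: "calm M (B \<union> X) p" and rich: "rich \<tau> M A p" and gap: "{last p, hd p} \<in> gaps M p"
    and AT: "A \<inter> T = {}" "finite T"
  obtains e q where "e \<in> complete_edges n - (M \<union> B \<union> X)" "position (Suc k) (insert e M) (B \<union> X) q"
    "progress M B p \<le> progress (insert e M) (B \<union> X) q"
    "card (gaps (insert e M) q) < card (gaps M p)"
    "card (frayed A T q) \<le> card (frayed A T p)"
proof -
  let ?B = "B \<union> X"
  note len = length_position[OF pos]
  have d: "distinct p" "set p = {..<n}" using pos by (auto simp: position_def)
  have finB: "finite ?B"
    by (rule finite_subset[OF _ finite_complete_edges]) (use pos X in \<open>auto simp: position_def\<close>)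
  have ne: "p \<noteq> []" using len n_ge by auto
  have hd: "hd p < n" using d(2) ne hd_in_set by blast
  have deg: "vdeg ?B (hd p) < \<tau>" using calm_exposed[OF calm hd] closing_gap_exposed[OF gap] by blast
  obtain R where R: "\<tau> < card R" "\<forall>e\<in>R. \<exists>q. rearranged M A p q \<and> last q = e" using rich by (auto simp: rich_def)
  have "vdeg ?B (hd p) < card R" using deg R(1) by linarith
  then obtain r where r: "r \<in> R" "{hd p, r} \<notin> ?B" using exists_free_partner[OF finB] by blast
  then obtain q where q: "rearranged M A p q" "last q = r" using R(2) by blast
  have q': "distinct q" "set q = {..<n}" "hd q = hd p" "pairs q \<subseteq> pairs p \<union> M"
    "\<And>y. y \<notin> A \<Longrightarrow> {z. {y, z} \<in> cyc p} \<subseteq> A \<Longrightarrow> {z. {y, z} \<in> cyc q} \<subseteq> A"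
    using q(1) d by (auto simp: rearranged_def)
  have lenq: "length q = n" using q'(1,2) by (metis card_lessThan distinct_card)
  have "hd q \<noteq> last q"
  proof
    assume eq: "hd q = last q"
    have qne: "q \<noteq> []" using lenq n_ge by auto
    then have "q ! 0 = q ! (length q - 1)" using eq by (simp add: hd_conv_nth last_conv_nth)
    then show False using nth_eq_iff_index_eq[OF q'(1), of 0 "length q - 1"] lenq n_ge by auto
  qed
  moreover have "r < n" using q(2) q'(2) lenq n_ge last_in_set[of q] by force
  ultimately have "{hd p, r} \<in> complete_edges n" using hd q(2) q'(3) by (auto simp: doubleton_in_complete_edges)
  then obtain e where e: "reply M ?B {hd p, r} e" using maker_can_reply[OF pos kK X] r(2) by blast
  let ?M = "insert e M"
  have "{last p, hd p} \<notin> pairs p" using closing_pair_not_in_pairs[OF d(1)] len n_ge by simp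
  moreover have "{last q, hd q} \<in> ?M" using e q(2) q'(3) by (auto simp: reply_def insert_commute)
  ultimately have sub: "gaps ?M q \<subseteq> gaps M p - {{last p, hd p}}"
    using q'(4) gap by (auto simp: gaps_def cyc_def)
  have adv: "\<And>v. v < n \<Longrightarrow> \<tau> \<le> vdeg ?B v \<Longrightarrow> gapdeg ?M q v \<le> gapdeg M p v"
    using sub by (intro gapdeg_antimono) blast
  note pa = position_advance[OF pos X kK e q'(1,2) adv disjI1[OF calm]]
  show ?thesis
  proof (rule that[of e q])
    show "e \<in> complete_edges n - (M \<union> B \<union> X)" using e by (auto simp: reply_def)
    show "position (Suc k) ?M ?B q" by (rule pa(1))
    show "progress M B p \<le> progress ?M ?B q" by (rule pa(2))
    have "card (gaps ?M q) \<le> card (gaps M p - {{last p, hd p}})" using sub by (intro card_mono) (auto simp: finite_gaps)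
    also have "\<dots> < card (gaps M p)" using gap by (intro card_Diff1_less) (auto simp: finite_gaps)
    finally show "card (gaps ?M q) < card (gaps M p)" .
    show "card (frayed A T q) \<le> card (frayed A T p)"
      using q'(5) AT by (intro card_mono) (auto simp: frayed_def)
  qed
qed

text \<open>
  The summand \<open>g0\<close> is a reserve: at the end of this stage the number of gaps is at most \<open>g0\<close>, and the
  next stage needs two moves for each of them.
\<close>

definition greedy_stage :: "nat \<Rightarrow> nat set set \<Rightarrow> nat set set \<Rightarrow> nat list \<Rightarrow> bool" where
  "greedy_stage k M B p \<longleftrightarrow> position k M B p \<and> k \<le> K \<and>
    k + 8 * N + card (gaps M p) + g0 + 9 * (t + 1) \<le> K + 2 * progress M B p"

text \<open>
  The edges of \<open>A\<close> into \<open>T\<close> bought so far are \<open>out\<close>. The flag \<open>f\<close> is 1 if the last move was a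
  jump, so that a merge can follow. Every move lowers \<open>2 * gaps - f - 2 * progress\<close> or the
  number of missing edges: a jump sets \<open>f\<close>, a merge resets it and removes a gap, and a move at a
  dangerous vertex may spoil \<open>f\<close> but raises the progress. Moves that rotate once fray at most four
  targets; purchases and merges fray none. So the number of frayed
  targets plus four times the first of these quantities never increases, and the purchases do not
  enter this bound.
\<close>

definition closing_stage :: "nat \<Rightarrow> nat set set \<Rightarrow> nat set set \<Rightarrow> nat list \<Rightarrow> nat set \<Rightarrow> nat set \<Rightarrow>
    (nat \<times> nat) set \<Rightarrow> nat \<Rightarrow> bool" where
  "closing_stage k M B p A T out f \<longleftrightarrow> position k M B p \<and> k \<le> K \<and>
    A \<inter> T = {} \<and> A \<subseteq> {..<n} \<and> T \<subseteq> {..<n} \<and> card A = t + 1 \<and> card T = t \<and>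
    out \<subseteq> A \<times> T \<and> (\<forall>a x. (a, x) \<in> out \<longrightarrow> {a, x} \<in> M) \<and> (\<forall>a. card (out `` {a}) \<le> 9) \<and>
    trap_potential t 9 s A T out < 1 \<and>
    f \<le> 1 \<and> (f = 1 \<longrightarrow> rich \<tau> M A p \<and> {last p, hd p} \<in> gaps M p) \<and>
    k + 8 * N + 2 * card (gaps M p) + (\<Sum>a\<in>A. 9 - card (out `` {a})) \<le> K + 2 * progress M B p + f \<and>
    card (frayed A T p) + 8 * card (gaps M p) \<le> 8 * g0 + 8 * progress M B p + 4 * f"

lemma t_pos: "0 < t" and s_le_t: "1000000 * s \<le> t"
  using t_ge s_ge tau_pos by auto

lemma no_gaps_wins:
  assumes "position k M B p" "gaps M p = {}"
  shows "\<exists>H. is_hamilton_cycle n H \<and> H \<subseteq> M"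
proof -
  have len: "length p = n" by (rule length_position[OF assms(1)])
  then have "p \<noteq> []" using n_ge by auto
  then have "cyc p = (\<lambda>i. {p ! i, p ! (Suc i mod n)}) ` {..<n}"
    using cyc_conv_nth[of p] len by simp
  then have "is_hamilton_cycle n (cyc p)"
    using assms(1) n_ge unfolding is_hamilton_cycle_def position_def by blast
  moreover have "cyc p \<subseteq> M" using assms(2) by (auto simp: gaps_def)
  ultimately show ?thesis by blast
qed

lemma closing_stage_urgent:
  assumes st: "closing_stage k M B p A T out f" and kK: "k < K"
    and X: "X \<subseteq> complete_edges n - (M \<union> B)" "card X \<le> b" and urgent: "\<not> calm M (B \<union> X) p"
  shows "\<exists>e p'. e \<in> complete_edges n - (M \<union> B \<union> X) \<and> closing_stage (Suc k) (insert e M) (B \<union> X) p' A T out 0"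
proof -
  have pos: "position k M B p" and fT: "finite T" using st by (auto simp: closing_stage_def intro: finite_subset)
  obtain e q where e: "e \<in> complete_edges n - (M \<union> B \<union> X)" "position (Suc k) (insert e M) (B \<union> X) q"
    and m: "progress M B p < progress (insert e M) (B \<union> X) q" "card (gaps (insert e M) q) \<le> card (gaps M p)"
      "card (frayed A T q) \<le> card (frayed A T p) + 4"
    using urgent_move[OF pos X kK urgent] fT by metis
  have "closing_stage (Suc k) (insert e M) (B \<union> X) q A T out 0"
    using st e m kK unfolding closing_stage_def by auto
  then show ?thesis using e by blast
qed

lemma closing_stage_merge:
  assumes st: "closing_stage k M B p A T out f" and kK: "k < K" and f: "f = 1"
    and X: "X \<subseteq> complete_edges n - (M \<union> B)" "card X \<le> b" and calm: "calm M (B \<union> X) p"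
  shows "\<exists>e p'. e \<in> complete_edges n - (M \<union> B \<union> X) \<and> closing_stage (Suc k) (insert e M) (B \<union> X) p' A T out 0"
proof -
  have pos: "position k M B p" and fT: "finite T" using st by (auto simp: closing_stage_def intro: finite_subset)
  have r: "rich \<tau> M A p" "{last p, hd p} \<in> gaps M p" "A \<inter> T = {}" using st f by (auto simp: closing_stage_def)
  obtain e q where e: "e \<in> complete_edges n - (M \<union> B \<union> X)" "position (Suc k) (insert e M) (B \<union> X) q"
    and m: "progress M B p \<le> progress (insert e M) (B \<union> X) q" "card (gaps (insert e M) q) < card (gaps M p)"
      "card (frayed A T q) \<le> card (frayed A T p)"
    using merge_move[OF pos X kK calm r fT] by metis
  have "closing_stage (Suc k) (insert e M) (B \<union> X) q A T out 0"
    using st e m kK f unfolding closing_stage_def by auto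
  then show ?thesis using e by blast
qed

lemma closing_stage_extend:
  assumes st: "closing_stage k M B p A T out 0" and kK: "k < K"
    and X: "X \<subseteq> complete_edges n - (M \<union> B)" "card X \<le> b" and calm: "calm M (B \<union> X) p"
    and a: "a \<in> A" "vdeg (B \<union> X) a < \<tau>" "card (out `` {a}) < 9"
  shows "\<exists>e x. e \<in> complete_edges n - (M \<union> B \<union> X) \<and>
    closing_stage (Suc k) (insert e M) (B \<union> X) p A T (insert (a, x) out) 0"
proof -
  let ?B = "B \<union> X"
  have pos: "position k M B p" and fin: "finite A" "finite T" and AT: "A \<inter> T = {}" "A \<subseteq> {..<n}" "T \<subseteq> {..<n}"
    and c: "card T = t" and out: "out \<subseteq> A \<times> T" and pot: "trap_potential t 9 s A T out < 1"
    using st by (auto simp: closing_stage_def intro: finite_subset)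
  have finB: "finite ?B"
    by (rule finite_subset[OF _ finite_complete_edges]) (use pos X in \<open>auto simp: position_def\<close>)
  have fout: "finite (out `` {a})" by (rule finite_subset[OF _ fin(2)]) (use out in auto)
  define C where "C = {x \<in> T. x \<notin> out `` {a} \<and> {a, x} \<notin> ?B}"
  have "T \<subseteq> C \<union> (out `` {a} \<union> {x \<in> T. {a, x} \<in> ?B})" by (auto simp: C_def)
  then have "t \<le> card (C \<union> (out `` {a} \<union> {x \<in> T. {a, x} \<in> ?B}))"
    unfolding c[symmetric] by (intro card_mono) (use fin fout in \<open>auto simp: C_def\<close>)
  also have "\<dots> \<le> card C + (card (out `` {a}) + card {x \<in> T. {a, x} \<in> ?B})"
    by (meson add_left_mono card_Un_le order_trans)
  also have "\<dots> \<le> card C + (9 + \<tau>)" using card_partners_le[OF finB, of T a] a by linarith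
  finally have "t \<le> 2 * card C" using s_le_t s_ge N_pos by linarith
  then have "real t \<le> 2 * real (card C)" by linarith
  then obtain x where x: "x \<in> C" "trap_potential t 9 s A T (insert (a, x) out) \<le> trap_potential t 9 s A T out"
    using trap_potential_extend[OF fin t_pos fout a(3), of C s] by (auto simp: C_def)
  have xC: "x \<in> T" "x \<notin> out `` {a}" "{a, x} \<notin> ?B" using x by (auto simp: C_def)
  have "{a, x} \<in> complete_edges n" using a(1) xC(1) AT by (auto simp: doubleton_in_complete_edges)
  then obtain e where e: "reply M ?B {a, x} e" using maker_can_reply[OF pos kK X] xC(3) by blast
  let ?M = "insert e M" and ?o = "insert (a, x) out"
  have d: "distinct p" "set p = {..<n}" using pos by (auto simp: position_def)
  have g: "gaps ?M p \<subseteq> gaps M p" by (auto simp: gaps_def)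
  have mono: "\<And>v. v < n \<Longrightarrow> \<tau> \<le> vdeg ?B v \<Longrightarrow> gapdeg ?M p v \<le> gapdeg M p v"
    by (rule gapdeg_antimono[OF g])
  note pa = position_advance[OF pos X kK e d mono disjI1[OF calm]]
  have ca: "card (?o `` {a}) = Suc (card (out `` {a}))"
  proof -
    have "?o `` {a} = insert x (out `` {a})" by auto
    then show ?thesis using xC(2) fout by simp
  qed
  have co: "?o `` {a'} = out `` {a'}" if "a' \<noteq> a" for a' using that by auto
  have "(\<Sum>a'\<in>A - {a}. 9 - card (?o `` {a'})) = (\<Sum>a'\<in>A - {a}. 9 - card (out `` {a'}))"
    by (intro sum.cong refl arg_cong[where f = "\<lambda>z. 9 - card z"] co) auto
  then have rem: "Suc (\<Sum>a'\<in>A. 9 - card (?o `` {a'})) = (\<Sum>a'\<in>A. 9 - card (out `` {a'}))"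
    using sum.remove[OF fin(1) a(1), of "\<lambda>a. 9 - card (out `` {a})"]
      sum.remove[OF fin(1) a(1), of "\<lambda>a. 9 - card (?o `` {a})"] ca a(3) by simp
  have deg: "card (?o `` {a'}) \<le> 9" for a'
    using ca co[of a'] a(3) st by (cases "a' = a") (auto simp: closing_stage_def)
  have "card (gaps ?M p) \<le> card (gaps M p)" by (rule card_mono[OF finite_gaps g])
  moreover have "progress M B p \<le> progress ?M ?B p" by (rule pa(2))
  moreover have "position (Suc k) ?M ?B p" by (rule pa(1))
  moreover have "{a', x'} \<in> ?M" if "(a', x') \<in> ?o" for a' x'
    using that e st by (auto simp: closing_stage_def reply_def)
  ultimately have "closing_stage (Suc k) ?M ?B p A T ?o 0"
    using st rem deg x(2) kK a(1) xC(1) unfolding closing_stage_def by auto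
  then show ?thesis using e by (auto simp: reply_def)
qed

text \<open>
  All vertices of \<open>A\<close> without a full set of edges are dangerous, so they fray few targets. The
  remaining core offers more targets than Breaker can have taken at the last vertex, even if those
  with a dangerous successor are avoided. The new closing pair may happen to be Maker's; then
  the gap is gone already and no merge is prepared.
\<close>

lemma closing_stage_jump:
  assumes st: "closing_stage k M B p A T out 0" and kK: "k < K"
    and X: "X \<subseteq> complete_edges n - (M \<union> B)" "card X \<le> b" and calm: "calm M (B \<union> X) p"
    and gaps: "gaps M p \<noteq> {}"
    and full: "\<And>a. a \<in> A \<Longrightarrow> vdeg (B \<union> X) a < \<tau> \<Longrightarrow> card (out `` {a}) = 9"
  shows "\<exists>e p' f'. e \<in> complete_edges n - (M \<union> B \<union> X) \<and> closing_stage (Suc k) (insert e M) (B \<union> X) p' A T out f'"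
proof -
  let ?B = "B \<union> X"
  have pos: "position k M B p" and fin: "finite A" "finite T" and AT: "A \<inter> T = {}" "A \<subseteq> {..<n}" "T \<subseteq> {..<n}"
    and c: "card T = t" and out: "out \<subseteq> A \<times> T" and pot: "trap_potential t 9 s A T out < 1"
    and outM: "\<And>a x. (a, x) \<in> out \<Longrightarrow> {a, x} \<in> M"
    using st by (auto simp: closing_stage_def intro: finite_subset)
  have sub: "?B \<subseteq> complete_edges n" using pos X by (auto simp: position_def)
  then have finB: "finite ?B" by (rule finite_subset) (rule finite_complete_edges)
  have "card ?B \<le> Suc k * b" using card_Un_le[of B X] pos X by (auto simp: position_def)
  also have "\<dots> \<le> K * b" using kK by (intro mult_le_mono1) simp
  finally have cB: "card ?B \<le> K * b" .
  obtain m where m: "0 < gapdeg M p m" using gaps_expose[OF gaps] by blast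
  obtain q where q: "cyc q = cyc p" "last q = m" "{m, hd q} \<in> gaps M q" "position k M B q"
    using exposed_has_gap[OF pos m] by blast
  note len = length_position[OF q(4)]
  have d: "distinct q" "set q = {..<n}" using q(4) by (auto simp: position_def)
  have ne: "q \<noteq> []" using len n_ge by auto
  have len3: "length q \<ge> 3" using len n_ge by simp
  have mn: "m < n" using q(2) d(2) ne last_in_set by blast
  have deg: "vdeg ?B m < \<tau>" using calm_exposed[OF calm mn m] .
  define Ac where "Ac = {a \<in> A. card (out `` {a}) = 9}"
  have AcA: "Ac \<subseteq> A" by (auto simp: Ac_def)
  have frayed: "card (frayed Ac T q) \<le> 36 * N + 8 * g0"
  proof -
    have "frayed Ac T q \<subseteq> frayed A T p \<union> (\<Union>a\<in>A - Ac. {x. {a, x} \<in> cyc q})"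
      using q(1) by (auto simp: frayed_def insert_commute)
    then have "card (frayed Ac T q) \<le> card (frayed A T p \<union> (\<Union>a\<in>A - Ac. {x. {a, x} \<in> cyc q}))"
      by (intro card_mono) (use fin card_cyc_nbrs(1)[OF d(1) ne] in \<open>auto simp: frayed_def\<close>)
    also have "\<dots> \<le> card (frayed A T p) + card (\<Union>a\<in>A - Ac. {x. {a, x} \<in> cyc q})" by (rule card_Un_le)
    also have "card (\<Union>a\<in>A - Ac. {x. {a, x} \<in> cyc q}) \<le> (\<Sum>a\<in>A - Ac. card {x. {a, x} \<in> cyc q})"
      by (rule card_UN_le) (use fin in auto)
    also have "\<dots> \<le> (\<Sum>a\<in>A - Ac. 2)" by (intro sum_mono card_cyc_nbrs[OF d(1) ne])
    also have "\<dots> = 2 * card (A - Ac)" by simp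
    also have "card (A - Ac) \<le> card {v \<in> {..<n}. \<tau> \<le> vdeg ?B v}"
      using full AT(2) by (intro card_mono) (auto simp: Ac_def not_less[symmetric])
    also have "\<dots> \<le> 2 * N" by (rule card_dangerous[OF sub cB])
    finally have "card (frayed Ac T q) \<le> card (frayed A T p) + 4 * N" by simp
    moreover have "progress M B p \<le> 4 * N" using progress_le[OF pos] kK by simp
    moreover have "card (frayed A T p) \<le> 8 * g0 + 8 * progress M B p" using st by (auto simp: closing_stage_def)
    ultimately show ?thesis by linarith
  qed
  have expand: "6 * card Y < card (\<Union> ((\<lambda>a. out `` {a}) ` Y))"
    if "Y \<subseteq> Ac" "Y \<noteq> {}" "card Y \<le> s" for Y
    by (rule trap_potential_expansion[OF fin pot out])
      (use that c s_le_t in \<open>auto simp: Ac_def\<close>)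
  have outAc: "\<And>a x. a \<in> Ac \<Longrightarrow> (a, x) \<in> out \<Longrightarrow> x \<in> T \<and> {a, x} \<in> M" using out outM by auto
  have slack: "card (frayed Ac T q) + 1 + \<tau> \<le> s" using frayed s_ge by linarith
  obtain I where I: "I \<subseteq> {..<length q - 1}" "card T \<le> card I + 3 * card (frayed Ac T q) + 3"
    and jump: "\<And>i M'. i \<in> I \<Longrightarrow> M \<subseteq> M' \<Longrightarrow> {last q, q ! i} \<in> M' \<Longrightarrow> q ! i \<in> T \<and> rich \<tau> M' A (rotate_at i q)"
    using jump_makes_rich[OF d(1) len3 AT(1) fin AcA outAc _ expand slack] AT(3) d(2) by auto
  define J where "J = {i \<in> I. \<not> \<tau> \<le> vdeg ?B (q ! Suc i)}"
  have fI: "finite I" using I(1) finite_subset by blast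
  have "I \<subseteq> J \<union> {i. i < n - 1 \<and> \<tau> \<le> vdeg ?B (q ! Suc i)}" using I(1) len by (auto simp: J_def)
  then have "card I \<le> card (J \<union> {i. i < n - 1 \<and> \<tau> \<le> vdeg ?B (q ! Suc i)})"
    by (intro card_mono) (use fI in \<open>auto simp: J_def\<close>)
  also have "\<dots> \<le> card J + card {i. i < n - 1 \<and> \<tau> \<le> vdeg ?B (q ! Suc i)}" by (rule card_Un_le)
  also have "\<dots> \<le> card J + 2 * N" using card_dangerous_successors[OF sub cB d] by simp
  finally have "\<tau> \<le> card J" using I(2) frayed s_ge s_le_t c by linarith
  then have "vdeg ?B m < card J" using deg by linarith
  also have "card J = card ((\<lambda>i. q ! i) ` J)"
  proof (rule card_image[symmetric])
    show "inj_on (\<lambda>i. q ! i) J" by (rule inj_on_nth[OF d(1)]) (use I(1) in \<open>auto simp: J_def\<close>)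
  qed
  finally obtain i where i: "i \<in> J" "{m, q ! i} \<notin> ?B"
    using exists_free_partner[OF finB, of m] by blast
  have i': "Suc i < length q" "\<not> \<tau> \<le> vdeg ?B (q ! Suc i)" "i \<in> I" using i I(1) by (auto simp: J_def)
  have "q ! i \<noteq> m" using nth_ne_last[OF d(1) i'(1)] q(2) by simp
  then have "{m, q ! i} \<in> complete_edges n"
    using mn d(2) nth_mem[of i q] i' by (auto simp: doubleton_in_complete_edges)
  then obtain e where e: "reply M ?B {m, q ! i} e" using maker_can_reply[OF pos kK X] i(2) by blast
  let ?M = "insert e M" and ?q = "rotate_at i q"
  have M: "M \<subseteq> ?M" "{last q, q ! i} \<in> ?M" using e q(2) by (auto simp: reply_def)
  have gap: "{last q, hd q} \<in> gaps M q" using q by simp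
  note gr = gaps_rotate_at[OF d(1) i'(1) len3 M gap]
  have gc: "gaps M q = gaps M p" by (rule gaps_cong[OF q(1)])
  have adv: "\<And>v. v < n \<Longrightarrow> \<tau> \<le> vdeg ?B v \<Longrightarrow> gapdeg ?M ?q v \<le> gapdeg M p v"
    using gr(1) i'(2) gapdeg_cong[OF q(1), of M] by metis
  note rp = rotate_at_props[OF d(1) i'(1)]
  have q': "distinct ?q" "set ?q = {..<n}" using rp d by auto
  note pa = position_advance[OF pos X kK e q' adv disjI1[OF calm]]
  have p': "position (Suc k) ?M ?B ?q" "progress M B p \<le> progress ?M ?B ?q"
    by (rule pa(1), assumption+, rule pa(2), assumption+)
  have fr: "card (frayed A T ?q) \<le> card (frayed A T p) + 4"
    using card_frayed_rotate_at[OF d(1) i'(1) fin(2), of A] frayed_cong[OF q(1), of A T] by simp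
  have outM': "\<forall>a x. (a, x) \<in> out \<longrightarrow> {a, x} \<in> ?M" using outM by blast
  have "\<exists>f'. closing_stage (Suc k) ?M ?B ?q A T out f'"
  proof (cases "{q ! Suc i, hd q} \<in> ?M")
    case True
    have "card (gaps ?M ?q) < card (gaps M p)" using gr(4)[OF True] gc by simp
    then have "closing_stage (Suc k) ?M ?B ?q A T out 0"
      using st p' fr outM' kK unfolding closing_stage_def by auto
    then show ?thesis by blast
  next
    case False
    have "{last ?q, hd ?q} \<in> gaps ?M ?q" using False rp by (auto simp: gaps_def cyc_def)
    moreover have "rich \<tau> ?M A ?q" using jump[OF i'(3) M] by blast
    moreover have "card (gaps ?M ?q) \<le> card (gaps M p)" using gr(3) gc by simp
    ultimately have "closing_stage (Suc k) ?M ?B ?q A T out 1"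
      using st p' fr outM' kK unfolding closing_stage_def by auto
    then show ?thesis by blast
  qed
  then show ?thesis using e by (auto simp: reply_def)
qed

lemma closing_stage_step:
  assumes st: "closing_stage k M B p A T out f" and gaps: "gaps M p \<noteq> {}"
    and X: "X \<subseteq> complete_edges n - (M \<union> B)" "card X \<le> b"
  shows "\<exists>e p' out' f'. e \<in> complete_edges n - (M \<union> B \<union> X) \<and>
    closing_stage (Suc k) (insert e M) (B \<union> X) p' A T out' f'"
proof -
  have pos: "position k M B p" "k \<le> K" and f: "f \<le> 1"
    and len: "k + 8 * N + 2 * card (gaps M p) \<le> K + 2 * progress M B p + f"
    using st by (auto simp: closing_stage_def)
  have "0 < card (gaps M p)" using gaps by (simp add: card_gt_0_iff finite_gaps)
  then have kK: "k < K" using len f progress_le[OF pos] by linarith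
  show ?thesis
  proof (cases "calm M (B \<union> X) p")
    case False
    then show ?thesis using closing_stage_urgent[OF st kK X] by blast
  next
    case calm: True
    show ?thesis
    proof (cases "f = 1")
      case True
      then show ?thesis using closing_stage_merge[OF st kK _ X calm] by blast
    next
      case False
      then have st0: "closing_stage k M B p A T out 0" using st f by (cases f) auto
      show ?thesis
      proof (cases "\<exists>a\<in>A. vdeg (B \<union> X) a < \<tau> \<and> card (out `` {a}) < 9")
        case True
        then show ?thesis using closing_stage_extend[OF st0 kK X calm] by blast
      next
        case False
        moreover have "card (out `` {a}) \<le> 9" for a using st by (auto simp: closing_stage_def)
        ultimately have "\<And>a. a \<in> A \<Longrightarrow> vdeg (B \<union> X) a < \<tau> \<Longrightarrow> card (out `` {a}) = 9"
          by (meson le_neq_implies_less)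
        then show ?thesis using closing_stage_jump[OF st0 kK X calm gaps] by blast
      qed
    qed
  qed
qed

text \<open>
  The targets are the vertices at odd positions in an initial part of the list, and \<open>A\<close> consists of the vertices
  at even positions around them. Initially no target is frayed.
\<close>

lemma closing_stage_starts:
  assumes st: "greedy_stage k M B p" and few: "card (gaps M p) \<le> g0"
  shows "\<exists>A T. closing_stage k M B p A T {} 0"
proof -
  have pos: "position k M B p" using st by (simp add: greedy_stage_def)
  note len = length_position[OF pos]
  have d: "distinct p" "set p = {..<n}" using pos by (auto simp: position_def)
  have ne: "p \<noteq> []" using len n_ge by auto
  define T where "T = (\<lambda>j. p ! Suc (2 * j)) ` {..<t}"
  define A where "A = (\<lambda>j. p ! (2 * j)) ` {..t}"
  have idx: "p ! i = p ! j \<longleftrightarrow> i = j" if "i \<le> 2 * t" "j \<le> 2 * t" for i j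
    using nth_eq_iff_index_eq[OF d(1), of i j] that t_fits len by linarith
  have cT: "card T = t" unfolding T_def by (subst card_image) (auto simp: inj_on_def idx)
  have cA: "card A = t + 1" unfolding A_def by (subst card_image) (auto simp: inj_on_def idx)
  have AT: "A \<inter> T = {}"
  proof -
    have "p ! (2 * i) \<noteq> p ! Suc (2 * j)" if "i \<le> t" "j < t" for i j
      using idx[of "2 * i" "Suc (2 * j)"] that by presburger
    then show ?thesis unfolding A_def T_def by auto
  qed
  have "p ! i < n" if "i \<le> 2 * t" for i using nth_mem[of i p] that len t_fits d(2) by auto
  then have sub: "A \<subseteq> {..<n}" "T \<subseteq> {..<n}" unfolding A_def T_def by auto
  then have fin: "finite A" "finite T" using finite_subset by blast+
  have fr: "frayed A T p = {}"
  proof -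
    have "y \<in> A" if j: "j < t" and y: "{p ! Suc (2 * j), y} \<in> cyc p" for j y
    proof -
      obtain i where i: "i < n" "{p ! Suc (2 * j), y} = {p ! i, p ! (Suc i mod n)}"
        using y cyc_conv_nth[OF ne] len by auto
      have small: "Suc (Suc (2 * j)) < n" using j t_fits by linarith
      have mem: "p ! (2 * j) \<in> A" "p ! Suc (Suc (2 * j)) \<in> A"
        unfolding A_def using j by (auto intro!: image_eqI[of _ _ "Suc j"])
      consider "p ! Suc (2 * j) = p ! i" "y = p ! (Suc i mod n)" | "p ! Suc (2 * j) = p ! (Suc i mod n)" "y = p ! i"
        using i(2) by (auto simp: doubleton_eq_iff)
      then show ?thesis
      proof cases
        case 1
        then have "i = Suc (2 * j)" using nth_eq_iff_index_eq[OF d(1), of i "Suc (2 * j)"] i(1) small len by auto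
        then show ?thesis using 1 mem small by simp
      next
        case 2
        then have e: "Suc i mod n = Suc (2 * j)"
          using nth_eq_iff_index_eq[OF d(1), of "Suc i mod n" "Suc (2 * j)"] i(1) small len by auto
        have "Suc i < n" using e i(1) by (cases "Suc i = n") auto
        then have "i = 2 * j" using e by simp
        then show ?thesis using 2 mem by simp
      qed
    qed
    then show ?thesis unfolding frayed_def T_def by auto
  qed
  have pot: "trap_potential t 9 s A T {} < 1"
    by (rule trap_potential_init[OF fin cT cA t_ge t_pos])
  have "(\<Sum>a\<in>A. 9 - card (({} :: (nat \<times> nat) set) `` {a})) = 9 * (t + 1)" using cA by simp
  then have "closing_stage k M B p A T {} 0"
    using st few cT cA AT sub pot fr unfolding greedy_stage_def closing_stage_def by auto
  then show ?thesis by blast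
qed

lemma greedy_stage_step:
  assumes st: "greedy_stage k M B p" and many: "g0 < card (gaps M p)"
    and X: "X \<subseteq> complete_edges n - (M \<union> B)" "card X \<le> b"
  shows "\<exists>e p'. e \<in> complete_edges n - (M \<union> B \<union> X) \<and> greedy_stage (Suc k) (insert e M) (B \<union> X) p'"
proof -
  have pos: "position k M B p" "k \<le> K"
    and len: "k + 8 * N + card (gaps M p) + g0 + 9 * (t + 1) \<le> K + 2 * progress M B p"
    using st by (auto simp: greedy_stage_def)
  have kK: "k < K" using len many progress_le[OF pos] by linarith
  show ?thesis
  proof (cases "calm M (B \<union> X) p")
    case True
    obtain e q where "e \<in> complete_edges n - (M \<union> B \<union> X)" "position (Suc k) (insert e M) (B \<union> X) q"
      "progress M B p \<le> progress (insert e M) (B \<union> X) q" "card (gaps (insert e M) q) < card (gaps M p)"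
      using greedy_move[OF pos(1) X kK True many] by metis
    then show ?thesis using len kK unfolding greedy_stage_def by (intro exI[of _ e] exI[of _ q]) auto
  next
    case False
    obtain e q where "e \<in> complete_edges n - (M \<union> B \<union> X)" "position (Suc k) (insert e M) (B \<union> X) q"
      "progress M B p < progress (insert e M) (B \<union> X) q" "card (gaps (insert e M) q) \<le> card (gaps M p)"
      using urgent_move[OF pos(1) X kK False] by metis
    then show ?thesis using len kK unfolding greedy_stage_def by (intro exI[of _ e] exI[of _ q]) auto
  qed
qed

lemma maker_wins: "maker_wins_within n b (real K)"
proof (rule maker_wins_by_invariant[where
    Inv = "\<lambda>k M B. \<exists>p. greedy_stage k M B p \<or> (\<exists>A T out f. closing_stage k M B p A T out f)"])
  have "position 0 {} {} [0..<n]"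
    by (auto simp: position_def box_inv_init atLeast0LessThan)
  moreover have "card (gaps {} [0..<n]) \<le> n" using card_gaps_le[of "[0..<n]" "{}"] n_ge by simp
  ultimately have "greedy_stage 0 {} {} [0..<n]" using time_limit by (simp add: greedy_stage_def)
  then show "\<exists>p. greedy_stage 0 {} {} p \<or> (\<exists>A T out f. closing_stage 0 {} {} p A T out f)" by blast
next
  fix k M B
  assume "\<exists>p. greedy_stage k M B p \<or> (\<exists>A T out f. closing_stage k M B p A T out f)"
  then show "real k \<le> real K" by (auto simp: greedy_stage_def closing_stage_def)
next
  fix k M B X
  assume inv: "\<exists>p. greedy_stage k M B p \<or> (\<exists>A T out f. closing_stage k M B p A T out f)"
    and open_game: "\<not> (\<exists>H. is_hamilton_cycle n H \<and> H \<subseteq> M)"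
    and X: "X \<subseteq> complete_edges n - (M \<union> B)" "card X \<le> b"
  obtain p where p: "greedy_stage k M B p \<or> (\<exists>A T out f. closing_stage k M B p A T out f)" using inv by blast
  then have "position k M B p" by (auto simp: greedy_stage_def closing_stage_def)
  then have gaps: "gaps M p \<noteq> {}" using no_gaps_wins open_game by blast
  consider (one) "greedy_stage k M B p" "g0 < card (gaps M p)" | (two) "\<exists>A T out f. closing_stage k M B p A T out f"
    using p closing_stage_starts not_le by metis
  then show "\<exists>e. e \<in> complete_edges n - (M \<union> B \<union> X) \<and>
      (\<exists>p. greedy_stage (Suc k) (insert e M) (B \<union> X) p \<or> (\<exists>A T out f. closing_stage (Suc k) (insert e M) (B \<union> X) p A T out f))"
  proof cases
    case one
    then show ?thesis using greedy_stage_step[OF one X] by blast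
  next
    case two
    then show ?thesis using closing_stage_step[OF _ gaps X] by meson
  qed
qed

end

section \<open>Large boards\<close>

lemma card_complete_edges: "real (card (complete_edges n)) = real n * (real n - 1) / 2"
proof -
  have "card (complete_edges n) = n choose 2"
    unfolding complete_edges_def using n_subsets[of "{..<n}" 2] by simp
  also have "real (n choose 2) = real n * (real n - 1) / 2"
    by (cases n) (auto simp: choose_two real_of_nat_div algebra_simps)
  finally show ?thesis .
qed

lemma maker_wins_within_mono: "maker_wins_within n b t \<Longrightarrow> t \<le> t' \<Longrightarrow> maker_wins_within n b t'"
  unfolding maker_wins_within_def by (meson order_trans)

text \<open>
  All parameters are constant multiples of \<open>w = n / sqrt (ln n)\<close>; the constant for \<open>t\<close> is the largest, and \<open>C\<close>
  exceeds what it contributes to \<open>K\<close>. The total of Breaker's edges is at most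
  \<open>2 * n * (n / ln n) = 2 * w * w\<close>, which fixes \<open>N\<close> and \<open>\<tau>\<close>.
\<close>

lemma maker_wins_large_n:
  fixes n b :: nat
  defines "C \<equiv> 2 * 10 ^ 9 :: real"
  assumes L: "C\<^sup>2 \<le> ln (real n)"
    and b: "real b \<le> real n / ln (real n) - C * real n / ln (real n) powr (3/2)"
  shows "maker_wins_within n b (real n + C * real n / ln (real n) powr (1/2))"
proof -
  define L where "L = ln (real n)"
  define w where "w = real n / sqrt L"
  have C: "C = 2000000000" by (simp add: C_def)
  have L_ge: "C\<^sup>2 \<le> L" using L by (simp add: L_def)
  have L1: "1 \<le> L" using L_ge by (simp add: C)
  have n0: "0 < real n"
  proof (rule ccontr)
    assume "\<not> 0 < real n"
    then show False using L1 by (simp add: L_def)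
  qed
  have L_le: "L \<le> real n - 1" unfolding L_def using n0 by (rule ln_le_minus_one)
  have L_large: "1000 \<le> L" using L_ge by (simp add: C)
  have sq: "C \<le> sqrt L" using L_ge by (simp add: real_le_rsqrt)
  have sq0: "0 < sqrt L" using L1 by simp
  have sqsq: "sqrt L * sqrt L = L" using L1 by simp
  have p1: "L powr (1/2) = sqrt L" using L1 by (simp add: powr_half_sqrt)
  have p3: "L powr (3/2) = L * sqrt L"
    using L1 powr_add[of L 1 "1/2"] by (simp add: powr_half_sqrt)
  have w1: "1 \<le> w"
  proof -
    have "sqrt L \<le> L" using L1 by (metis mult_left_mono mult.right_neutral real_sqrt_ge_1_iff sq0 less_imp_le sqsq)
    then show ?thesis unfolding w_def using L_le sq0 by (simp add: field_simps)
  qed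
  have Cw: "C * w \<le> real n"
    using mult_right_mono[OF sq, of "real n"] sq0 n0 by (simp add: w_def field_simps)
  have ww: "w * w = real n * real n / L" unfolding w_def using sqsq by simp
  have bL: "real b * L \<le> real n - C * w"
  proof -
    have "real b * L \<le> (real n / L - C * real n / (L * sqrt L)) * L"
      using b L1 by (intro mult_right_mono) (simp_all add: L_def[symmetric] p3)
    also have "\<dots> = real n - C * w" using L1 sq0 by (simp add: w_def field_simps)
    finally show ?thesis .
  qed
  have bn: "real b * L \<le> real n" using bL w1 by (simp add: C)
  have bw: "real b \<le> w"
  proof -
    have "1 \<le> sqrt L" using L1 by simp
    then have "real b * 1 \<le> real b * sqrt L" by (intro mult_left_mono) auto
    also have "\<dots> \<le> w"
    proof -
      have "(real b * sqrt L) * sqrt L \<le> real n" using bn sqsq by (simp add: mult.assoc)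
      then show ?thesis unfolding w_def using sq0 by (simp add: pos_le_divide_eq)
    qed
    finally show ?thesis by simp
  qed
  define \<tau> where "\<tau> = nat \<lceil>w\<rceil>"
  define N where "N = nat \<lceil>2 * w\<rceil>"
  define s where "s = 36 * N + 8 * \<tau> + 1 + \<tau>"
  define t where "t = 10 ^ 6 * s"
  define K where "K = n + 8 * N + \<tau> + 9 * (t + 1)"
  have tau: "w \<le> real \<tau>" "real \<tau> \<le> 2 * w" using w1 unfolding \<tau>_def by linarith+
  have N: "2 * w \<le> real N" "real N \<le> 3 * w" using w1 unfolding N_def by linarith+
  have s: "real s \<le> 127 * w" using tau N w1 unfolding s_def by simp
  have t: "real t \<le> 127000000 * w" using s unfolding t_def by simp
  have K: "real K \<le> real n + C * w" using t tau N w1 unfolding K_def by (simp add: C)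
  have K2: "real K \<le> 2 * real n" using K Cw by simp
  have "hamilton_strategy n b \<tau> N \<tau> s t K"
  proof
    show "3 \<le> n" using L_le L_large by linarith
    show "0 < \<tau>" "1 \<le> N" using tau N w1 by linarith+
    have "real K * real b \<le> 2 * real n * real b" using K2 by (intro mult_right_mono) auto
    also have "\<dots> \<le> 2 * real n * (real n / L)" using bn L1 by (intro mult_left_mono) (auto simp: field_simps)
    also have "\<dots> = 2 * w * w" using ww by simp
    also have "\<dots> \<le> real N * real \<tau>" using N tau w1 by (intro mult_mono) auto
    finally show "K * b \<le> N * \<tau>" by (simp only: of_nat_mult[symmetric] of_nat_le_iff)
    have "real K * (real b + 1) \<le> 2 * real n * ((real n - 1) / 4)"
    proof (intro mult_mono)
      have "8 * real b \<le> L * real b" using L_large by (intro mult_right_mono) auto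
      then have "8 * real b \<le> real n" using bn by (simp add: mult.commute)
      then show "real b + 1 \<le> (real n - 1) / 4" using L_le L_large by (simp add: field_simps)
    qed (use K2 n0 in auto)
    also have "\<dots> = real (card (complete_edges n))" by (simp add: card_complete_edges)
    finally have "real (K * (b + 1)) \<le> real (card (complete_edges n))"
      by (simp only: of_nat_mult of_nat_add of_nat_1)
    then show "K * (b + 1) \<le> card (complete_edges n)" by (simp only: of_nat_le_iff)
    have "real N \<le> real n" using N Cw w1 by (simp add: C)
    then have "ln (real N) \<le> L" unfolding L_def using N w1 by simp
    then have "real b * ln (real N) \<le> real n - C * w"
      using bL mult_left_mono[of "ln (real N)" L "real b"] by simp
    then show "real \<tau> + real b * ln (real N) + real N + 2 * real b + 2 * real N + 1 < real n"
      using tau N bw w1 by (simp add: C)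
    show "36 * N + 8 * \<tau> + 1 + \<tau> \<le> s" by (simp add: s_def)
    show "10 ^ 6 * s \<le> t" by (simp add: t_def)
    have "real (2 * t + 1) \<le> real n" using t Cw w1 by (simp add: C)
    then show "2 * t + 1 \<le> n" by (simp only: of_nat_le_iff)
    show "n + 8 * N + \<tau> + 9 * (t + 1) \<le> K" by (simp add: K_def)
  qed simp
  then have "maker_wins_within n b (real K)" by (rule hamilton_strategy.maker_wins)
  moreover have "real K \<le> real n + C * real n / ln (real n) powr (1/2)"
    using K by (simp add: w_def p1 L_def[symmetric])
  ultimately show ?thesis by (rule maker_wins_within_mono)
qed

theorem theorem1:
  "\<exists>C::real. \<forall>\<^sub>F n::nat in sequentially. \<forall>b::nat.
     b > 0 \<and> real b \<le> real n / ln (real n) - C * real n / ln (real n) powr (3/2) \<longrightarrow>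
       maker_wins_within n b (real n + C * real n / ln (real n) powr (1/2))"
proof -
  have "filterlim (\<lambda>n. ln (real n)) at_top sequentially"
    by (rule filterlim_compose[OF ln_at_top filterlim_real_sequentially])
  then have "\<forall>\<^sub>F n in sequentially. (2 * 10 ^ 9 :: real)\<^sup>2 \<le> ln (real n)"
    by (simp only: filterlim_at_top)
  then show ?thesis
    by (intro exI[of _ "2 * 10 ^ 9"], elim eventually_mono) (use maker_wins_large_n in blast)
qed

end
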